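(* Let $\mathcal F\in\{A\mathrm J,B\mathrm J,A\mathrm M,B\mathrm M\}$ be any of the four families of interpolation polynomials and let $\lambda,\mu,\nu\in\mathcal P_n$. If $\lambda\gtrdot\mu$, then $$c_{\mu\nu}^\lambda=a_{\lambda\mu}\bigl(b_{\lambda\nu}-b_{\mu\nu}\bigr).$$ More generally, if $\lambda\supseteq\mu$, then for any saturated chain $\zeta=(\zeta_0,\dots,\zeta_k)$ from $\lambda$ to $\mu$, $$b_{\lambda\nu}-b_{\mu\nu}=\sum_{i=0}^{k-1}\frac{c_{\zeta_{i+1}\nu}^{\zeta_i}}{a_{\zeta_i\zeta_{i+1}}}.$$
   Context: Fix $n\geqslant1$. $\mathcal P_n=\{\lambda\in\mathbb Z^n:\lambda_1\geqslant\cdots\geqslant\lambda_n\geqslant0\}$, $|\lambda|=\lambda_1+\dots+\lambda_n$; $\lambda\supseteq\mu$ means $\lambda_i\geqslant\mu_i$ for all $i$; $\lambda\gtrdot\mu$ means $\lambda\supseteq\mu$ and $|\lambda|=|\mu|+1$. A saturated chain from $\lambda$ to $\mu$ is a sequence in $\mathcal P_n$ with $\lambda=\zeta_0\gtrdot\zeta_1\gtrdot\cdots\gtrdot\zeta_k=\mu$, $k=|\lambda|-|\mu|$. The four families $\mathcal F$ have the following data (base field $\mathbb F$, ring $\Lambda$, shifting map $\mathcal P_n\to\mathbb F^n$, $\lambda\mapsto\overline\lambda$), with indeterminate parameters: - $A\mathrm J$: $\mathbb F=\mathbb Q(\tau)$; $\Lambda=\mathbb F[x_1,\dots,x_n]^{S_n}$;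 $\overline\lambda_i=\lambda_i+(n-i)\tau$. - $B\mathrm J$: $\mathbb F=\mathbb Q(\tau,\alpha)$; $\Lambda=\mathbb F[x_1^2,\dots,x_n^2]^{S_n}$; $\overline\lambda_i=\lambda_i+(n-i)\tau+\alpha$. - $A\mathrm M$: $\mathbb F=\mathbb Q(q,t)$; $\Lambda=\mathbb F[x_1,\dots,x_n]^{S_n}$; $\overline\lambda_i=q^{\lambda_i}t^{n-i}$. - $B\mathrm M$: $\mathbb F=\mathbb Q(q,t,a)$; $\Lambda=\mathbb F[x_1+x_1^{-1},\dots,x_n+x_n^{-1}]^{S_n}$; $\overline\lambda_i=aq^{\lambda_i}t^{n-i}$. The degree of a Laurent polynomial is the maximum of $|\alpha_1|+\dots+|\alpha_n|$ over monomials $x^\alpha$ occurring in it. For $\mu\in\mathcal P_n$, the (unital) interpolation polynomial $h_\mu$ is the unique element of $\Lambda$ of degree at most $|\mu|$ (at most $2|\mu|$ when $\mathcal F=B\mathrm J$) with $h_\mu(\overline\lambda)=\delta_{\lambda\mu}$ for all $\lambda\in\mathcal P_n$ with $|\lambda|\leqslant|\mu|$ (existence and uniqueness are known). The binomial coefficients are $b_{\lambda\mu}=h_\mu(\overline\lambda)\in\mathbb F$; for $\lambda\gtrdot\mu$ the adjacent binomial coefficient is $a_{\lambda\mu}=b_{\lambda\mu}$. The $h_\lambda$ form an $\mathbb F$-basis of $\Lambda$, and the Littlewood–Richardson coefficients $c_{\mu\nu}^\lambda\in\mathbb F$ are defined by $h_\mu h_\nu=\sum_\lambda c_{\mu\nu}^\lambda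 h_\lambda$. *)

theory Defs
  imports
    "HOL-Library.Poly_Mapping"
    "HOL-Computational_Algebra.Polynomial"
    "HOL-Computational_Algebra.Fraction_Field"
    "HOL-Combinatorics.Permutations"
begin

text \<open>Partitions with at most \<open>n\<close> parts are functions supported on the indices \<open>1, \<dots>, n\<close>;
  requiring the value 0 elsewhere makes equality of functions equality of partitions.\<close>

definition parts :: "nat \<Rightarrow> (nat \<Rightarrow> nat) set" where
  "parts n = {l. (\<forall>i\<in>{1..n}. \<forall>j\<in>{1..n}. i \<le> j \<longrightarrow> l j \<le> l i) \<and> (\<forall>i. i \<notin> {1..n} \<longrightarrow> l i = 0)}"

definition weight :: "nat \<Rightarrow> (nat \<Rightarrow> nat) \<Rightarrow> nat" where
  "weight n l = (\<Sum>i=1..n. l i)"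

definition contains :: "nat \<Rightarrow> (nat \<Rightarrow> nat) \<Rightarrow> (nat \<Rightarrow> nat) \<Rightarrow> bool" where
  "contains n l m \<longleftrightarrow> (\<forall>i\<in>{1..n}. m i \<le> l i)"

definition covers :: "nat \<Rightarrow> (nat \<Rightarrow> nat) \<Rightarrow> (nat \<Rightarrow> nat) \<Rightarrow> bool" where
  "covers n l m \<longleftrightarrow> contains n l m \<and> weight n l = weight n m + 1"

definition saturated_chain ::
    "nat \<Rightarrow> (nat \<Rightarrow> nat) list \<Rightarrow> (nat \<Rightarrow> nat) \<Rightarrow> (nat \<Rightarrow> nat) \<Rightarrow> bool" where
  "saturated_chain n zs l m \<longleftrightarrow>
     set zs \<subseteq> parts n \<and> length zs = (weight n l - weight n m) + 1 \<and>
     hd zs = l \<and> last zs = m \<and>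
     (\<forall>i < weight n l - weight n m. covers n (zs ! i) (zs ! Suc i))"

text \<open>Laurent polynomials in the variables \<open>x\<^sub>i\<close>: finitely supported functions from exponent vectors
  to coefficients, with the convolution product of \<open>Poly_Mapping\<close>. All four rings of interest are
  subrings; the three ordinary polynomial rings only contain elements with nonnegative exponents.\<close>

type_synonym 'f laurent = "(nat \<Rightarrow>\<^sub>0 int) \<Rightarrow>\<^sub>0 'f"

definition Const :: "'f::field \<Rightarrow> 'f laurent" where
  "Const c = Poly_Mapping.single 0 c"

definition X :: "nat \<Rightarrow> 'f::field laurent" where
  "X i = Poly_Mapping.single (Poly_Mapping.single i 1) 1"

definition X_inv :: "nat \<Rightarrow> 'f::field laurent" where
  "X_inv i = Poly_Mapping.single (Poly_Mapping.single i (- 1)) 1"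

text \<open>The zero polynomial gets degree 0, so it satisfies every degree bound.\<close>

definition laurent_degree :: "'f::field laurent \<Rightarrow> nat" where
  "laurent_degree f =
     Max (insert 0 ((\<lambda>m. \<Sum>i\<in>Poly_Mapping.keys m. nat \<bar>Poly_Mapping.lookup m i\<bar>) ` Poly_Mapping.keys f))"

definition laurent_eval :: "'f::field laurent \<Rightarrow> (nat \<Rightarrow> 'f) \<Rightarrow> 'f" where
  "laurent_eval f x =
     (\<Sum>m\<in>Poly_Mapping.keys f. Poly_Mapping.lookup f m *
        (\<Prod>i\<in>Poly_Mapping.keys m. x i powi Poly_Mapping.lookup m i))"

text \<open>Invariance under permutations of \<open>x\<^sub>1, \<dots>, x\<^sub>n\<close>: exponent vectors in the same orbit have the same
  coefficient; \<open>map_key p m\<close> is the exponent vector \<open>m \<circ> p\<close>.\<close>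

definition symmetric :: "nat \<Rightarrow> 'f::field laurent \<Rightarrow> bool" where
  "symmetric n f \<longleftrightarrow>
     (\<forall>p. p permutes {1..n} \<longrightarrow>
        (\<forall>m. Poly_Mapping.lookup f (Poly_Mapping.map_key p m) = Poly_Mapping.lookup f m))"

inductive_set subalgebra_gen :: "'f::field laurent set \<Rightarrow> 'f laurent set" for S where
  const: "Const c \<in> subalgebra_gen S"
| gen: "f \<in> S \<Longrightarrow> f \<in> subalgebra_gen S"
| add: "f \<in> subalgebra_gen S \<Longrightarrow> g \<in> subalgebra_gen S \<Longrightarrow> f + g \<in> subalgebra_gen S"
| mult: "f \<in> subalgebra_gen S \<Longrightarrow> g \<in> subalgebra_gen S \<Longrightarrow> f * g \<in> subalgebra_gen S"

text \<open>A family consists of the generators \<open>y\<^sub>i\<close> of the ring \<open>F[y\<^sub>1, \<dots>, y\<^sub>n]\<close> whose symmetric elements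
  are considered, the factor in the degree bound, and the shifting map for each \<open>n\<close> (only its values
  at the indices \<open>1, \<dots>, n\<close> matter).\<close>

record (overloaded) 'f family =
  fam_gen :: "nat \<Rightarrow> 'f laurent"
  fam_deg :: nat
  fam_shift :: "nat \<Rightarrow> (nat \<Rightarrow> nat) \<Rightarrow> nat \<Rightarrow> 'f"

definition Lam :: "'f::field family \<Rightarrow> nat \<Rightarrow> 'f laurent set" where
  "Lam F n = {f \<in> subalgebra_gen (fam_gen F ` {1..n}). symmetric n f}"

definition interp_poly :: "'f::field family \<Rightarrow> nat \<Rightarrow> (nat \<Rightarrow> nat) \<Rightarrow> 'f laurent" where
  "interp_poly F n m =
     (THE h. h \<in> Lam F n \<and> laurent_degree h \<le> fam_deg F * weight n m \<and>
        (\<forall>l\<in>parts n. weight n l \<le> weight n m \<longrightarrow>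
           laurent_eval h (fam_shift F n l) = (if l = m then 1 else 0)))"

definition binom_coeff :: "'f::field family \<Rightarrow> nat \<Rightarrow> (nat \<Rightarrow> nat) \<Rightarrow> (nat \<Rightarrow> nat) \<Rightarrow> 'f" where
  "binom_coeff F n l m = laurent_eval (interp_poly F n m) (fam_shift F n l)"

text \<open>The adjacent binomial coefficient is meant for \<open>covers n l m\<close> only.\<close>

definition adj_binom_coeff :: "'f::field family \<Rightarrow> nat \<Rightarrow> (nat \<Rightarrow> nat) \<Rightarrow> (nat \<Rightarrow> nat) \<Rightarrow> 'f" where
  "adj_binom_coeff F n l m = binom_coeff F n l m"

text \<open>\<open>LR_coeff F n m v l\<close> is the coefficient of \<open>h\<^sub>l\<close> in the expansion of \<open>h\<^sub>m h\<^sub>v\<close>.\<close>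

definition LR_coeff ::
    "'f::field family \<Rightarrow> nat \<Rightarrow> (nat \<Rightarrow> nat) \<Rightarrow> (nat \<Rightarrow> nat) \<Rightarrow> (nat \<Rightarrow> nat) \<Rightarrow> 'f" where
  "LR_coeff F n m v l =
     Poly_Mapping.lookup
       (THE c :: (nat \<Rightarrow> nat) \<Rightarrow>\<^sub>0 'f. Poly_Mapping.keys c \<subseteq> parts n \<and>
          interp_poly F n m * interp_poly F n v =
            (\<Sum>k\<in>Poly_Mapping.keys c. Const (Poly_Mapping.lookup c k) * interp_poly F n k)) l"

text \<open>The base fields are realised as fraction fields of iterated polynomial rings over the
  rationals, as follows:
  \<open>Q(\<tau>)\<close>; \<open>Q(\<tau>, \<alpha>)\<close> with \<open>\<alpha>\<close> outermost; \<open>Q(q, t)\<close> with \<open>t\<close> outermost; and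
  \<open>Q(q, t, a)\<close> with \<open>a\<close> outermost, then \<open>t\<close>.\<close>

definition AJ :: "rat poly fract family" where
  "AJ = (let \<tau> = Fract [:0, 1:] 1 in
     \<lparr>fam_gen = X, fam_deg = 1,
      fam_shift = (\<lambda>n l i. of_nat (l i) + of_nat (n - i) * \<tau>)\<rparr>)"

definition BJ :: "rat poly poly fract family" where
  "BJ = (let \<tau> = Fract [:[:0, 1:]:] 1; \<alpha> = Fract [:0, 1:] 1 in
     \<lparr>fam_gen = (\<lambda>i. X i ^ 2), fam_deg = 2,
      fam_shift = (\<lambda>n l i. of_nat (l i) + of_nat (n - i) * \<tau> + \<alpha>)\<rparr>)"

definition AM :: "rat poly poly fract family" where
  "AM = (let q = Fract [:[:0, 1:]:] 1; t = Fract [:0, 1:] 1 in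
     \<lparr>fam_gen = X, fam_deg = 1,
      fam_shift = (\<lambda>n l i. q ^ l i * t ^ (n - i))\<rparr>)"

definition BM :: "rat poly poly poly fract family" where
  "BM = (let q = Fract [:[:[:0, 1:]:]:] 1; t = Fract [:[:0, 1:]:] 1; a = Fract [:0, 1:] 1 in
     \<lparr>fam_gen = (\<lambda>i. X i + X_inv i), fam_deg = 1,
      fam_shift = (\<lambda>n l i. a * q ^ l i * t ^ (n - i))\<rparr>)"

end

theory Submission
  imports Defs
begin

text \<open>Write \<open>b\<^bsub>lm\<^esub>\<close> for the value of \<open>h\<^sub>m\<close> at the node of \<open>l\<close>. By definition \<open>b\<^bsub>mm\<^esub> = 1\<close>, and \<open>b\<^bsub>lm\<^esub> = 0\<close> if \<open>l \<noteq> m\<close> has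
  weight at most that of \<open>m\<close>. Evaluating \<open>h\<^sub>m h\<^sub>v = \<Sum>\<^sub>k c\<^sub>k h\<^sub>k\<close> at the nodes in order of increasing weight
  shows that up to the weight of \<open>m\<close> the only coefficient that can be nonzero is \<open>c\<^sub>m = b\<^bsub>mv\<^esub>\<close>. If \<open>l\<close> covers \<open>m\<close>, evaluating
  at the node of \<open>l\<close> therefore gives \<open>b\<^bsub>lm\<^esub> b\<^bsub>lv\<^esub> = c\<^sub>l + b\<^bsub>lm\<^esub> b\<^bsub>mv\<^esub>\<close>, which is the first formula
  (\<open>LR_coeff_cover\<close>). Divided by the adjacent binomial coefficients, it telescopes along a saturated
  chain (\<open>binom_coeff_diff_chain\<close>). The division requires these coefficients to be nonzero.

  What needs work is that the interpolation polynomials exist and are unique, and that adjacent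
  binomial coefficients do not vanish. Both follow by specialising the parameters, to \<open>\<tau> = 0\<close> in the
  Jack cases and to \<open>t = 1\<close> in the Macdonald cases, with suitable values for the others. In terms of
  the generators \<open>y\<^sub>i\<close> of the ring, the node of \<open>l\<close> then becomes \<open>(u(l\<^sub>1), \<dots>, u(l\<^sub>n))\<close> with one strictly
  increasing sequence \<open>u\<close>. The elements of degree at most \<open>d\<close> (up to the factor in the degree bound) are
  spanned by symmetrised Newton products \<open>\<Sum>\<^sub>p \<Prod>\<^sub>i \<Prod>\<^bsub>r<e(p(i))\<^esub> (y\<^sub>i - u\<^sub>r)\<close> for partitions \<open>e\<close> of weight at
  most \<open>d\<close>, where \<open>u\<^sub>r\<close> lifts \<open>u(r)\<close> (\<open>Lam_degree_lincomb_orbit_sum\<close>). After specialisation such a sum has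
  only nonnegative terms at the node of \<open>l\<close>; it is positive if \<open>e\<close> is contained in \<open>l\<close>, and zero if \<open>e \<noteq> l\<close>
  has weight at least that of \<open>l\<close>. So the matrix of values is triangular with nonzero diagonal after
  specialisation, and therefore invertible before it (\<open>triangular_system\<close>); this settles existence and
  uniqueness. If \<open>l\<close> covers \<open>m\<close>, replacing the row of \<open>m\<close> by that of \<open>l\<close> keeps the matrix for the weight of
  \<open>m\<close> triangular, which shows that \<open>h\<^sub>m\<close> cannot vanish at the node of \<open>l\<close>
  (\<open>interpolation_unique_cover\<close>).\<close>

section \<open>Linear systems that become triangular after specialisation\<close>

text \<open>The relation \<open>sp x a\<close> says that \<open>x\<close> is regular at a chosen special point of the parameters and
  takes the value \<open>a\<close> there. It stands for the residue map of the local ring at that point; as a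
  relation, it needs no separate type for that ring.\<close>

locale specialization =
  fixes sp :: "'f::field \<Rightarrow> 'k::field \<Rightarrow> bool"
  assumes sp_1: "sp 1 1"
    and sp_add: "sp x a \<Longrightarrow> sp y b \<Longrightarrow> sp (x + y) (a + b)"
    and sp_uminus: "sp x a \<Longrightarrow> sp (- x) (- a)"
    and sp_mult: "sp x a \<Longrightarrow> sp y b \<Longrightarrow> sp (x * y) (a * b)"
    and sp_divide: "sp x a \<Longrightarrow> sp y b \<Longrightarrow> b \<noteq> 0 \<Longrightarrow> sp (x / y) (a / b)"
    and sp_nonzero: "sp x a \<Longrightarrow> a \<noteq> 0 \<Longrightarrow> x \<noteq> 0"
begin

lemma sp_diff: "sp x a \<Longrightarrow> sp y b \<Longrightarrow> sp (x - y) (a - b)"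
  using sp_add[of x a "- y" "- b"] sp_uminus[of y b] by simp

lemma sp_0: "sp 0 0"
  using sp_diff[OF sp_1 sp_1] by simp

lemma sp_sum: "(\<And>i. i \<in> I \<Longrightarrow> sp (x i) (a i)) \<Longrightarrow> sp (sum x I) (sum a I)"
  by (induction I rule: infinite_finite_induct) (auto intro: sp_0 sp_add)

lemma sp_prod: "(\<And>i. i \<in> I \<Longrightarrow> sp (x i) (a i)) \<Longrightarrow> sp (prod x I) (prod a I)"
  by (induction I rule: infinite_finite_induct) (auto intro: sp_1 sp_mult)

lemma sp_power: "sp x a \<Longrightarrow> sp (x ^ m) (a ^ m)"
  by (induction m) (auto intro: sp_1 sp_mult)

lemma sp_of_nat: "sp (of_nat m) (of_nat m)"
  by (induction m) (auto intro: sp_0 sp_1 sp_add)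

text \<open>Gaussian elimination over the local ring. The row of least rank \<open>w\<close> specialises to a multiple of a
  unit vector. Its pivot is therefore a unit, and clearing its column in the other rows leaves the
  specialised values of all remaining entries unchanged, so that the smaller system satisfies the same
  hypotheses with the same \<open>E'\<close>.\<close>

lemma triangular_system:
  fixes w :: "'i \<Rightarrow> nat"
  assumes "finite I"
    and "\<And>i j. i \<in> I \<Longrightarrow> j \<in> I \<Longrightarrow> sp (E i j) (E' i j)"
    and "\<And>i. i \<in> I \<Longrightarrow> E' i i \<noteq> 0"
    and "\<And>i j. i \<in> I \<Longrightarrow> j \<in> I \<Longrightarrow> i \<noteq> j \<Longrightarrow> E' i j \<noteq> 0 \<Longrightarrow> w j < w i"
  shows "(\<exists>c. \<forall>i\<in>I. (\<Sum>j\<in>I. E i j * c j) = b i) \<and>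
    (\<forall>c. (\<forall>i\<in>I. (\<Sum>j\<in>I. E i j * c j) = 0) \<longrightarrow> (\<forall>j\<in>I. c j = 0))"
  using assms
proof (induction "card I" arbitrary: I E b)
  case 0
  then show ?case by simp
next
  case (Suc N)
  have "I \<noteq> {}" using Suc.hyps(2) by auto
  then obtain p where p: "p \<in> I" and min: "\<And>j. j \<in> I \<Longrightarrow> w p \<le> w j"
    using ex_has_least_nat[of "\<lambda>i. i \<in> I" _ w] by blast
  define J where "J = I - {p}"
  define E2 where "E2 i j = E i j - E i p * E p j / E p p" for i j
  have J: "finite J" "N = card J" "p \<notin> J" and I: "I = insert p J"
    using Suc.hyps(2) Suc.prems(1) p by (auto simp: J_def)
  have split: "(\<Sum>j\<in>I. g j) = g p + (\<Sum>j\<in>J. g j)" for g :: "'i \<Rightarrow> 'f"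
    using J by (simp add: I)
  \<comment> \<open>minimality of the rank of \<open>p\<close> leaves no room for another nonzero entry in its row\<close>
  have zero: "E' p j = 0" if "j \<in> J" for j
    using Suc.prems(4)[OF p, of j] min[of j] that by (force simp: J_def)
  have pivot: "E p p \<noteq> 0"
    using sp_nonzero Suc.prems(2,3) p by blast
  have "sp (E2 i j) (E' i j)" if "i \<in> J" "j \<in> J" for i j
  proof -
    have "sp (E2 i j) (E' i j - E' i p * E' p j / E' p p)"
      unfolding E2_def using that p Suc.prems(2,3)
      by (intro sp_diff sp_divide sp_mult) (auto simp: J_def)
    then show ?thesis using zero[OF that(2)] by simp
  qed
  then have IH: "(\<exists>c. \<forall>i\<in>J. (\<Sum>j\<in>J. E2 i j * c j) = b' i) \<and>
    (\<forall>c. (\<forall>i\<in>J. (\<Sum>j\<in>J. E2 i j * c j) = 0) \<longrightarrow> (\<forall>j\<in>J. c j = 0))" for b'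
    using Suc.prems(3,4) J by (intro Suc.hyps(1)) (auto simp: J_def)
  have E2_sum: "(\<Sum>j\<in>J. E2 i j * c j)
      = (\<Sum>j\<in>J. E i j * c j) - E i p / E p p * (\<Sum>j\<in>J. E p j * c j)" for i c
    by (simp add: E2_def algebra_simps sum_subtractf sum_distrib_left)
  show ?case
  proof (intro conjI allI impI)
    obtain c where c: "\<And>i. i \<in> J \<Longrightarrow> (\<Sum>j\<in>J. E2 i j * c j) = b i - E i p / E p p * b p"
      using IH[of "\<lambda>i. b i - E i p / E p p * b p"] by auto
    define c' where "c' = c(p := (b p - (\<Sum>j\<in>J. E p j * c j)) / E p p)"
    have eq: "(\<Sum>j\<in>J. E i j * c' j) = (\<Sum>j\<in>J. E i j * c j)" for i
      using J(3) by (intro sum.cong) (auto simp: c'_def)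
    have "(\<Sum>j\<in>I. E i j * c' j) = b i" if "i \<in> I" for i
    proof (cases "i = p")
      case True
      then show ?thesis unfolding split eq using pivot by (simp add: c'_def)
    next
      case False
      then have "i \<in> J" using that by (simp add: J_def)
      then show ?thesis
        using c[of i] pivot unfolding split eq E2_sum by (simp add: c'_def field_simps)
    qed
    then show "\<exists>c. \<forall>i\<in>I. (\<Sum>j\<in>I. E i j * c j) = b i" by blast
  next
    fix c assume c: "\<forall>i\<in>I. (\<Sum>j\<in>I. E i j * c j) = 0"
    have row: "(\<Sum>j\<in>J. E i j * c j) = - (E i p * c p)" if "i \<in> I" for i
      using c that unfolding split by (metis add_eq_0_iff)
    have "(\<Sum>j\<in>J. E2 i j * c j) = 0" if "i \<in> J" for i
      unfolding E2_sum using that pivot row[OF p] row[of i] by (simp add: I)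
    then have cJ: "c j = 0" if "j \<in> J" for j using IH that by blast
    then have "c p = 0" using row[OF p] pivot by simp
    then show "\<forall>j\<in>I. c j = 0" using cJ by (auto simp: I)
  qed
qed

end

text \<open>With equality as the specialisation relation, \<open>triangular_system\<close> is the solvability of ordinary
  triangular systems; it is applied in this form to the matrix of binomial coefficients.\<close>

interpretation equality: specialization "(=) :: 'f::field \<Rightarrow> 'f \<Rightarrow> bool"
  by unfold_locales auto

section \<open>Partitions and exponent vectors\<close>

definition exps :: "nat \<Rightarrow> (nat \<Rightarrow> nat) set" where
  "exps n = {e. \<forall>i. i \<notin> {1..n} \<longrightarrow> e i = 0}"

definition parts_upto :: "nat \<Rightarrow> nat \<Rightarrow> (nat \<Rightarrow> nat) set" where
  "parts_upto n d = {l \<in> parts n. weight n l \<le> d}"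

lemma parts_exps: "l \<in> parts n \<Longrightarrow> l \<in> exps n"
  by (simp add: parts_def exps_def)

lemma exps_permute: "e \<in> exps n \<Longrightarrow> p permutes {1..n} \<Longrightarrow> e \<circ> p \<in> exps n"
  by (auto simp: exps_def permutes_def)

lemma weight_permute: "p permutes {1..n} \<Longrightarrow> weight n (e \<circ> p) = weight n e"
  unfolding weight_def comp_def by (rule sum.permute[symmetric, unfolded comp_def])

lemma finite_parts_upto: "finite (parts_upto n d)"
proof (rule finite_subset)
  let ?L = "{l. \<forall>i. (i \<in> {1..n} \<longrightarrow> l i \<in> {..d}) \<and> (i \<notin> {1..n} \<longrightarrow> l i = 0)}"
  show "finite ?L"
    by (rule finite_set_of_finite_funs) auto
  show "parts_upto n d \<subseteq> ?L"
  proof (clarsimp simp: parts_upto_def parts_def)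
    fix l :: "nat \<Rightarrow> nat" and i
    assume "weight n l \<le> d" "Suc 0 \<le> i" "i \<le> n"
    then show "l i \<le> d" unfolding weight_def
      using member_le_sum[of i "{1..n}" l] by (auto intro: order_trans)
  qed
qed

text \<open>The indices at which a partition is at least \<open>v\<close> form an initial segment, so a partition is
  determined by the cardinalities of these sets, which do not change under permutation.\<close>

lemma parts_level_iff:
  assumes "l \<in> parts n" "i \<in> {1..n}"
  shows "v \<le> l i \<longleftrightarrow> i \<le> card {j \<in> {1..n}. v \<le> l j}"
proof
  assume "v \<le> l i"
  then have "{1..i} \<subseteq> {j \<in> {1..n}. v \<le> l j}"
    using assms by (fastforce simp: parts_def)
  from card_mono[OF _ this] show "i \<le> card {j \<in> {1..n}. v \<le> l j}" by simp
next
  assume le: "i \<le> card {j \<in> {1..n}. v \<le> l j}"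
  show "v \<le> l i"
  proof (rule ccontr)
    assume "\<not> v \<le> l i"
    then have "{j \<in> {1..n}. v \<le> l j} \<subseteq> {1..<i}"
      using assms by (fastforce simp: parts_def not_le)
    from card_mono[OF _ this] have "card {j \<in> {1..n}. v \<le> l j} < i" using assms(2) by auto
    with le show False by simp
  qed
qed

lemma parts_permute_unique:
  assumes "l \<in> parts n" "m \<in> parts n" "p permutes {1..n}" "m \<circ> p = l"
  shows "l = m"
proof (rule ext)
  fix i
  show "l i = m i"
  proof (cases "i \<in> {1..n}")
    case True
    have "p ` {j \<in> {1..n}. v \<le> l j} = {j \<in> {1..n}. v \<le> m j}" for v
    proof (intro equalityI subsetI)
      fix x assume x: "x \<in> {j \<in> {1..n}. v \<le> m j}"
      define y where "y = inv p x"
      have xy: "p y = x" using assms(3) by (simp add: y_def permutes_inverses)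
      then have "y \<in> {1..n}" "v \<le> l y"
        using x permutes_in_image[OF assms(3), of y] by (simp_all flip: assms(4))
      with xy show "x \<in> p ` {j \<in> {1..n}. v \<le> l j}" by blast
    next
      fix x assume "x \<in> p ` {j \<in> {1..n}. v \<le> l j}"
      then obtain y where "x = p y" "y \<in> {1..n}" "v \<le> l y" by blast
      then show "x \<in> {j \<in> {1..n}. v \<le> m j}"
        using permutes_in_image[OF assms(3), of y] by (simp flip: assms(4))
    qed
    then have "card {j \<in> {1..n}. v \<le> l j} = card {j \<in> {1..n}. v \<le> m j}" for v
      using card_image[OF permutes_inj_on[OF assms(3)]] by metis
    then have "v \<le> l i \<longleftrightarrow> v \<le> m i" for v
      using parts_level_iff[OF assms(1) True] parts_level_iff[OF assms(2) True] by simp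
    then show ?thesis by (meson order_antisym order_refl)
  next
    case False
    then show ?thesis using assms(1,2) by (auto simp: parts_def)
  qed
qed

text \<open>A permutation that maximises \<open>\<Sum>\<^sub>i (n - i) e(p(i))\<close> sorts \<open>e\<close>: exchanging two entries in the wrong
  order would increase this sum.\<close>

lemma ex_permute_parts:
  assumes "e \<in> exps n"
  shows "\<exists>p. p permutes {1..n} \<and> e \<circ> p \<in> parts n"
proof -
  define S where "S p = (\<Sum>i=1..n. int (n - i) * int (e (p i)))" for p
  let ?M = "S ` {p. p permutes {1..n}}"
  have fin: "finite ?M" by (simp add: finite_permutations)
  have "?M \<noteq> {}" using permutes_id by blast
  then have "Max ?M \<in> ?M" using fin by (rule Max_in[rotated])
  then obtain p where p: "p permutes {1..n}" and Sp: "S p = Max ?M" by auto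
  have max: "S p' \<le> S p" if "p' permutes {1..n}" for p'
    unfolding Sp using fin that by (intro Max_ge) auto
  have "e (p j) \<le> e (p i)" if ij: "i \<in> {1..n}" "j \<in> {1..n}" "i \<le> j" for i j
  proof (rule ccontr)
    assume less: "\<not> e (p j) \<le> e (p i)"
    then have neq: "i < j" using ij(3) by (metis le_neq_implies_less order_refl)
    define p' where "p' = p \<circ> Transposition.transpose i j"
    have p': "p' permutes {1..n}"
      unfolding p'_def by (intro permutes_compose permutes_swap_id ij p)
    have split: "(\<Sum>k=1..n. g k) = g i + g j + (\<Sum>k\<in>{1..n}-{i}-{j}. g k)" for g :: "nat \<Rightarrow> int"
      using ij neq by (subst sum.remove[of _ i], simp, simp, subst sum.remove[of _ j]) auto
    have rest: "(\<Sum>k\<in>{1..n}-{i}-{j}. int (n - k) * int (e (p' k)))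
        = (\<Sum>k\<in>{1..n}-{i}-{j}. int (n - k) * int (e (p k)))"
      by (intro sum.cong) (auto simp: p'_def)
    have "S p' - S p = (int j - int i) * (int (e (p j)) - int (e (p i)))"
      unfolding S_def split rest using ij by (simp add: p'_def of_nat_diff algebra_simps)
    also have "\<dots> > 0" using neq less by simp
    finally show False using max[OF p'] by simp
  qed
  then show ?thesis
    using p exps_permute[OF assms p] by (intro exI[of _ p]) (auto simp: parts_def exps_def)
qed

section \<open>Laurent polynomials\<close>

lemma lookup_Const_mult: "Poly_Mapping.lookup (Const c * f) m = c * Poly_Mapping.lookup f m"
  by (simp add: Const_def mult_map_scale_conv_mult[symmetric] Poly_Mapping.map.rep_eq when_def)

lemma Const_simps: "Const 0 = 0" "Const 1 = 1" "Const (a + b) = Const a + Const b"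
  "Const (a * b) = Const a * Const b" "Const (- a) = - Const a"
  by (simp_all add: Const_def single_add mult_single single_uminus)

lemma sum_monomials:
  fixes f :: "'a \<Rightarrow>\<^sub>0 'b::comm_monoid_add"
  shows "(\<Sum>m\<in>Poly_Mapping.keys f. Poly_Mapping.single m (Poly_Mapping.lookup f m)) = f"
proof (rule poly_mapping_eqI)
  fix k
  show "Poly_Mapping.lookup
     (\<Sum>m\<in>Poly_Mapping.keys f. Poly_Mapping.single m (Poly_Mapping.lookup f m)) k
     = Poly_Mapping.lookup f k"
    by (auto simp: lookup_sum Poly_Mapping.lookup_single when_def in_keys_iff)
qed

lemma laurent_induct [case_names zero add]:
  fixes f :: "'f::field laurent"
  assumes "P 0" and "\<And>m c f. P f \<Longrightarrow> P (Poly_Mapping.single m c + f)"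
  shows "P f"
proof -
  have "P (\<Sum>m\<in>A. Poly_Mapping.single m (Poly_Mapping.lookup f m))" for A
    by (induction A rule: infinite_finite_induct) (use assms in auto)
  from this[of "Poly_Mapping.keys f"] show ?thesis by (simp only: sum_monomials)
qed

definition eval_monom :: "(nat \<Rightarrow>\<^sub>0 int) \<Rightarrow> (nat \<Rightarrow> 'f::field) \<Rightarrow> 'f" where
  "eval_monom m x = (\<Prod>i\<in>Poly_Mapping.keys m. x i powi Poly_Mapping.lookup m i)"

text \<open>In the family \<open>AJ\<close> the last coordinate of a node can be 0, and \<open>0 powi (- 1) = 0\<close>. Evaluation is
  multiplicative as long as no coordinate that occurs with a negative exponent vanishes.\<close>

definition evaluable :: "(nat \<Rightarrow> 'f::field) \<Rightarrow> 'f laurent \<Rightarrow> bool" where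
  "evaluable x f \<longleftrightarrow> (\<forall>m\<in>Poly_Mapping.keys f. \<forall>i. Poly_Mapping.lookup m i < 0 \<longrightarrow> x i \<noteq> 0)"

lemma eval_monom_superset:
  assumes "finite A" "Poly_Mapping.keys m \<subseteq> A"
  shows "eval_monom m x = (\<Prod>i\<in>A. x i powi Poly_Mapping.lookup m i)"
  unfolding eval_monom_def using assms
  by (intro prod.mono_neutral_left) (auto simp: in_keys_iff)

lemma eval_monom_add:
  assumes "\<And>i. Poly_Mapping.lookup m i < 0 \<or> Poly_Mapping.lookup m' i < 0 \<Longrightarrow> x i \<noteq> 0"
  shows "eval_monom (m + m') x = eval_monom m x * eval_monom m' x"
proof -
  let ?A = "Poly_Mapping.keys m \<union> Poly_Mapping.keys m'"
  have "x i powi (Poly_Mapping.lookup m i + Poly_Mapping.lookup m' i)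
      = x i powi Poly_Mapping.lookup m i * x i powi Poly_Mapping.lookup m' i" for i
  proof (cases "x i = 0")
    case True
    then have "0 \<le> Poly_Mapping.lookup m i" "0 \<le> Poly_Mapping.lookup m' i"
      using assms[of i] by (auto simp: not_less[symmetric])
    then show ?thesis using True by (auto simp: power_int_0_left_if)
  qed (simp add: power_int_add)
  then show ?thesis
    using keys_add[of m m']
    by (simp add: eval_monom_superset[of ?A] lookup_add prod.distrib)
qed

lemma laurent_eval_superset:
  assumes "finite A" "Poly_Mapping.keys f \<subseteq> A"
  shows "laurent_eval f x = (\<Sum>m\<in>A. Poly_Mapping.lookup f m * eval_monom m x)"
  unfolding laurent_eval_def eval_monom_def[symmetric] using assms
  by (intro sum.mono_neutral_left) (auto simp: in_keys_iff)

lemma laurent_eval_add: "laurent_eval (f + g) x = laurent_eval f x + laurent_eval g x"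
proof -
  let ?A = "Poly_Mapping.keys f \<union> Poly_Mapping.keys g"
  show ?thesis
    using keys_add[of f g]
    by (simp add: laurent_eval_superset[of ?A] lookup_add algebra_simps sum.distrib)
qed

lemma laurent_eval_0: "laurent_eval 0 x = 0"
  by (simp add: laurent_eval_def)

lemma laurent_eval_sum: "laurent_eval (sum g A) x = (\<Sum>a\<in>A. laurent_eval (g a) x)"
  by (induction A rule: infinite_finite_induct) (auto simp: laurent_eval_0 laurent_eval_add)

lemma laurent_eval_single: "laurent_eval (Poly_Mapping.single m c) x = c * eval_monom m x"
  by (auto simp: laurent_eval_def eval_monom_def)

lemma laurent_eval_Const: "laurent_eval (Const c) x = c"
  by (simp add: Const_def laurent_eval_single eval_monom_def)

lemma laurent_eval_1: "laurent_eval 1 x = 1"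
  using laurent_eval_Const[of 1 x] by (simp add: Const_simps)

lemma laurent_eval_mult:
  assumes "evaluable x f" "evaluable x g"
  shows "laurent_eval (f * g) x = laurent_eval f x * laurent_eval g x"
proof -
  let ?s = "\<lambda>h m. Poly_Mapping.single m (Poly_Mapping.lookup h m)"
  have "f * g = (\<Sum>m\<in>Poly_Mapping.keys f. ?s f m) * (\<Sum>m\<in>Poly_Mapping.keys g. ?s g m)"
    by (simp only: sum_monomials)
  also have "\<dots> = (\<Sum>m\<in>Poly_Mapping.keys f. \<Sum>m'\<in>Poly_Mapping.keys g.
      Poly_Mapping.single (m + m') (Poly_Mapping.lookup f m * Poly_Mapping.lookup g m'))"
    by (simp add: sum_product mult_single)
  finally have "laurent_eval (f * g) x = (\<Sum>m\<in>Poly_Mapping.keys f. \<Sum>m'\<in>Poly_Mapping.keys g.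
      Poly_Mapping.lookup f m * Poly_Mapping.lookup g m' * eval_monom (m + m') x)"
    by (simp add: laurent_eval_sum laurent_eval_single)
  also have "\<dots> = (\<Sum>m\<in>Poly_Mapping.keys f. \<Sum>m'\<in>Poly_Mapping.keys g.
      (Poly_Mapping.lookup f m * eval_monom m x) * (Poly_Mapping.lookup g m' * eval_monom m' x))"
    using assms by (intro sum.cong refl) (subst eval_monom_add, auto simp: evaluable_def)
  also have "\<dots> = laurent_eval f x * laurent_eval g x"
    by (simp only: sum_product laurent_eval_superset[OF finite_keys order_refl])
  finally show ?thesis .
qed

lemma evaluable_add: "evaluable x f \<Longrightarrow> evaluable x g \<Longrightarrow> evaluable x (f + g)"
  using keys_add[of f g] unfolding evaluable_def by blast

lemma evaluable_mult:
  assumes "evaluable x f" "evaluable x g"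
  shows "evaluable x (f * g)"
  unfolding evaluable_def
proof (intro ballI allI impI)
  fix m i assume "m \<in> Poly_Mapping.keys (f * g)" and neg: "Poly_Mapping.lookup m i < 0"
  then obtain a b where "m = a + b" "a \<in> Poly_Mapping.keys f" "b \<in> Poly_Mapping.keys g"
    using keys_mult[of f g] by blast
  moreover from this neg have "Poly_Mapping.lookup a i < 0 \<or> Poly_Mapping.lookup b i < 0"
    by (auto simp: lookup_add)
  ultimately show "x i \<noteq> 0" using assms by (auto simp: evaluable_def)
qed

lemma evaluable_Const: "evaluable x (Const c)"
  by (auto simp: evaluable_def Const_def)

lemma evaluable_subalgebra:
  assumes "f \<in> subalgebra_gen S" "\<And>g. g \<in> S \<Longrightarrow> evaluable x g"
  shows "evaluable x f"
  using assms(1)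
  by induction (auto intro: assms(2) evaluable_Const evaluable_add evaluable_mult)

lemma laurent_eval_prod:
  assumes "\<And>i. i \<in> A \<Longrightarrow> evaluable x (g i)"
  shows "evaluable x (prod g A) \<and> laurent_eval (prod g A) x = (\<Prod>i\<in>A. laurent_eval (g i) x)"
  using assms
  by (induction A rule: infinite_finite_induct)
     (use evaluable_Const[of x 1] in
       \<open>auto simp: laurent_eval_1 Const_simps laurent_eval_mult evaluable_mult\<close>)

section \<open>Degrees and leading exponents\<close>

definition abs_degree :: "(nat \<Rightarrow>\<^sub>0 int) \<Rightarrow> nat" where
  "abs_degree m = (\<Sum>i\<in>Poly_Mapping.keys m. nat \<bar>Poly_Mapping.lookup m i\<bar>)"

text \<open>Additive in the exponent, unlike \<open>abs_degree\<close>, and bounded by it. It serves to track leading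
  exponents through products and then to bound \<open>laurent_degree\<close> from below.\<close>

definition signed_degree :: "(nat \<Rightarrow>\<^sub>0 int) \<Rightarrow> int" where
  "signed_degree m = (\<Sum>i\<in>Poly_Mapping.keys m. Poly_Mapping.lookup m i)"

lemma signed_degree_le: "signed_degree m \<le> int (abs_degree m)"
  unfolding signed_degree_def abs_degree_def of_nat_sum by (intro sum_mono) simp

lemma abs_degree_superset:
  assumes "finite A" "Poly_Mapping.keys m \<subseteq> A"
  shows "abs_degree m = (\<Sum>i\<in>A. nat \<bar>Poly_Mapping.lookup m i\<bar>)"
  unfolding abs_degree_def using assms
  by (intro sum.mono_neutral_left) (auto simp: in_keys_iff)

lemma signed_degree_superset:
  assumes "finite A" "Poly_Mapping.keys m \<subseteq> A"
  shows "signed_degree m = (\<Sum>i\<in>A. Poly_Mapping.lookup m i)"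
  unfolding signed_degree_def using assms
  by (intro sum.mono_neutral_left) (auto simp: in_keys_iff)

lemma signed_degree_add: "signed_degree (m + m') = signed_degree m + signed_degree m'"
proof -
  let ?A = "Poly_Mapping.keys m \<union> Poly_Mapping.keys m'"
  show ?thesis
    using keys_add[of m m']
    by (simp add: signed_degree_superset[of ?A] lookup_add sum.distrib)
qed

lemma signed_degree_single: "signed_degree (Poly_Mapping.single i s) = s"
  by (simp add: signed_degree_def)

lemma abs_degree_single: "abs_degree (Poly_Mapping.single i s) = nat \<bar>s\<bar>"
  by (simp add: abs_degree_def)

lemma abs_degree_add: "abs_degree (m + m') \<le> abs_degree m + abs_degree m'"
proof -
  let ?A = "Poly_Mapping.keys m \<union> Poly_Mapping.keys m'"
  have "(\<Sum>i\<in>?A. nat \<bar>Poly_Mapping.lookup m i + Poly_Mapping.lookup m' i\<bar>)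
      \<le> (\<Sum>i\<in>?A. nat \<bar>Poly_Mapping.lookup m i\<bar> + nat \<bar>Poly_Mapping.lookup m' i\<bar>)"
    by (intro sum_mono) linarith
  then show ?thesis
    using keys_add[of m m']
    by (simp add: abs_degree_superset[of ?A] lookup_add sum.distrib)
qed

lemma laurent_degree_le_iff:
  "laurent_degree f \<le> D \<longleftrightarrow> (\<forall>m\<in>Poly_Mapping.keys f. abs_degree m \<le> D)"
  unfolding laurent_degree_def abs_degree_def by (subst Max_le_iff) auto

lemma laurent_degree_add:
  "laurent_degree f \<le> D \<Longrightarrow> laurent_degree g \<le> D \<Longrightarrow> laurent_degree (f + g) \<le> D"
  using keys_add[of f g] unfolding laurent_degree_le_iff by blast

lemma laurent_degree_mult:
  assumes "laurent_degree f \<le> D" "laurent_degree g \<le> D'"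
  shows "laurent_degree (f * g) \<le> D + D'"
  unfolding laurent_degree_le_iff
proof
  fix m assume "m \<in> Poly_Mapping.keys (f * g)"
  then obtain a b where "m = a + b" "a \<in> Poly_Mapping.keys f" "b \<in> Poly_Mapping.keys g"
    using keys_mult[of f g] by blast
  then show "abs_degree m \<le> D + D'"
    using assms abs_degree_add[of a b] unfolding laurent_degree_le_iff by fastforce
qed

lemma laurent_degree_Const: "laurent_degree (Const c) \<le> D"
  by (simp add: laurent_degree_le_iff Const_def abs_degree_def)

lemma laurent_degree_Const_mult: "laurent_degree f \<le> D \<Longrightarrow> laurent_degree (Const c * f) \<le> D"
  using laurent_degree_mult[OF laurent_degree_Const[of c 0]] by fastforce

lemma laurent_degree_sum:
  "(\<And>a. a \<in> A \<Longrightarrow> laurent_degree (g a) \<le> D) \<Longrightarrow> laurent_degree (sum g A) \<le> D"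
  by (induction A rule: infinite_finite_induct)
     (auto intro: laurent_degree_add simp: laurent_degree_le_iff[of 0])

lemma laurent_degree_prod:
  "(\<And>a. a \<in> A \<Longrightarrow> laurent_degree (g a) \<le> D a) \<Longrightarrow> laurent_degree (prod g A) \<le> sum D A"
  using laurent_degree_Const[of 1 0]
  by (induction A rule: infinite_finite_induct) (auto intro: laurent_degree_mult simp: Const_simps)

text \<open>Having a single exponent of maximal signed degree, with coefficient 1, is inherited by products and
  holds for the linear factors of the Newton products, so no monomial order is required.\<close>

definition monic_at :: "(nat \<Rightarrow>\<^sub>0 int) \<Rightarrow> 'f::field laurent \<Rightarrow> bool" where
  "monic_at a f \<longleftrightarrow> (\<exists>g. f = Poly_Mapping.single a 1 + g \<and>
     (\<forall>m\<in>Poly_Mapping.keys g. signed_degree m < signed_degree a))"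

lemma monic_at_one: "monic_at 0 1"
  unfolding monic_at_def by (intro exI[of _ 0]) simp

lemma monic_at_mult:
  fixes f f' :: "'f::field laurent"
  assumes "monic_at a f" "monic_at a' f'"
  shows "monic_at (a + a') (f * f')"
proof -
  obtain g g' where f: "f = Poly_Mapping.single a 1 + g" "f' = Poly_Mapping.single a' 1 + g'"
    and g: "\<And>m. m \<in> Poly_Mapping.keys g \<Longrightarrow> signed_degree m < signed_degree a"
    and g': "\<And>m. m \<in> Poly_Mapping.keys g' \<Longrightarrow> signed_degree m < signed_degree a'"
    using assms unfolding monic_at_def by blast
  define h where "h = Poly_Mapping.single a 1 * g' + g * Poly_Mapping.single a' 1 + g * g'"
  have "f * f' = Poly_Mapping.single (a + a') 1 + h"
    by (simp add: f h_def algebra_simps mult_single)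
  moreover have "signed_degree m < signed_degree (a + a')" if m: "m \<in> Poly_Mapping.keys h" for m
  proof -
    have keys: "\<exists>b b'. m = b + b' \<and> b \<in> Poly_Mapping.keys u \<and> b' \<in> Poly_Mapping.keys v"
      if "m \<in> Poly_Mapping.keys (u * v)" for u v :: "'f laurent"
      using subsetD[OF keys_mult that] by simp
    consider "m \<in> Poly_Mapping.keys (Poly_Mapping.single a (1::'f) * g')"
      | "m \<in> Poly_Mapping.keys (g * Poly_Mapping.single a' 1)" | "m \<in> Poly_Mapping.keys (g * g')"
      using m subsetD[OF keys_add] unfolding h_def by (metis Un_iff)
    then show ?thesis
    proof cases
      case 1
      from keys[OF this] show ?thesis by (auto simp: signed_degree_add dest: g')
    next
      case 2
      from keys[OF this] show ?thesis by (auto simp: signed_degree_add dest: g)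
    next
      case 3
      from keys[OF this] show ?thesis by (auto simp: signed_degree_add dest!: g g')
    qed
  qed
  ultimately show ?thesis unfolding monic_at_def by blast
qed

lemma monic_at_prod:
  "(\<And>i. i \<in> A \<Longrightarrow> monic_at (a i) (f i)) \<Longrightarrow> monic_at (sum a A) (prod f A)"
  by (induction A rule: infinite_finite_induct) (auto intro: monic_at_one monic_at_mult)

lemma monic_at_lookup:
  assumes "monic_at a f" "signed_degree a \<le> signed_degree m"
  shows "Poly_Mapping.lookup f m = (if m = a then 1 else 0)"
proof -
  obtain g where f: "f = Poly_Mapping.single a 1 + g"
    and g: "\<And>m. m \<in> Poly_Mapping.keys g \<Longrightarrow> signed_degree m < signed_degree a"
    using assms unfolding monic_at_def by blast
  have "m \<notin> Poly_Mapping.keys g" using g assms(2) by force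
  then show ?thesis by (auto simp: f lookup_add in_keys_iff Poly_Mapping.lookup_single)
qed

section \<open>Permutation of the variables\<close>

text \<open>The automorphism \<open>x\<^sub>i \<mapsto> x\<^bsub>p(i)\<^esub>\<close>: the outer \<open>map_key\<close> reindexes the coefficients by the map that the
  inner one induces on exponent vectors.\<close>

definition permute_vars :: "(nat \<Rightarrow> nat) \<Rightarrow> 'f::field laurent \<Rightarrow> 'f laurent" where
  "permute_vars p f = Poly_Mapping.map_key (Poly_Mapping.map_key p) f"

lemma map_key_inverse:
  assumes "p permutes A"
  shows "Poly_Mapping.map_key p (Poly_Mapping.map_key (inv p) m) = m"
    "Poly_Mapping.map_key (inv p) (Poly_Mapping.map_key p m) = m"
  using assms permutes_inj[OF assms] permutes_inj[OF permutes_inv[OF assms]]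
  by (simp_all add: map_key_compose permutes_inv_o map_key_id id_def)

lemma inj_map_key: "p permutes A \<Longrightarrow> inj (Poly_Mapping.map_key p :: (nat \<Rightarrow>\<^sub>0 int) \<Rightarrow> _)"
  by (rule inj_on_inverseI[where g = "Poly_Mapping.map_key (inv p)"]) (simp add: map_key_inverse)

context
  fixes p :: "nat \<Rightarrow> nat" and A :: "nat set"
  assumes p: "p permutes A"
begin

lemma lookup_permute_vars:
  "Poly_Mapping.lookup (permute_vars p f) m = Poly_Mapping.lookup f (Poly_Mapping.map_key p m)"
  unfolding permute_vars_def by (simp add: map_key.rep_eq[OF inj_map_key[OF p]])

lemma permute_vars_0: "permute_vars p 0 = 0"
  by (rule poly_mapping_eqI) (simp add: lookup_permute_vars)

lemma permute_vars_add: "permute_vars p (f + g) = permute_vars p f + permute_vars p g"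
  by (rule poly_mapping_eqI) (simp add: lookup_permute_vars lookup_add)

lemma permute_vars_sum: "permute_vars p (sum g B) = (\<Sum>b\<in>B. permute_vars p (g b))"
  by (induction B rule: infinite_finite_induct) (auto simp: permute_vars_0 permute_vars_add)

lemma permute_vars_single:
  "permute_vars p (Poly_Mapping.single m c) = Poly_Mapping.single (Poly_Mapping.map_key (inv p) m) c"
proof (rule poly_mapping_eqI)
  fix k
  have "m = Poly_Mapping.map_key p k \<longleftrightarrow> Poly_Mapping.map_key (inv p) m = k"
    using map_key_inverse[OF p] by metis
  then show "Poly_Mapping.lookup (permute_vars p (Poly_Mapping.single m c)) k
      = Poly_Mapping.lookup (Poly_Mapping.single (Poly_Mapping.map_key (inv p) m) c) k"
    by (simp add: lookup_permute_vars Poly_Mapping.lookup_single)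
qed

lemma permute_vars_single_var:
  "permute_vars p (Poly_Mapping.single (Poly_Mapping.single i s) c)
     = Poly_Mapping.single (Poly_Mapping.single (p i) s) c"
proof -
  have "Poly_Mapping.map_key (inv p) (Poly_Mapping.single (inv p (p i)) s)
      = Poly_Mapping.single (p i) s"
    using permutes_inj[OF permutes_inv[OF p]] by (intro map_key_single)
  then show ?thesis using permutes_inverses[OF p] by (simp add: permute_vars_single)
qed

lemma permute_vars_mult: "permute_vars p (f * g) = permute_vars p f * permute_vars p g"
proof -
  have inj: "inj (inv p)" using permutes_inj[OF permutes_inv[OF p]] .
  have single: "permute_vars p (Poly_Mapping.single m c * g)
      = permute_vars p (Poly_Mapping.single m c) * permute_vars p g" for m c
    by (induction g rule: laurent_induct)
       (simp_all add: permute_vars_0 permute_vars_add algebra_simps mult_single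
         permute_vars_single map_key_plus[OF inj])
  show ?thesis
    by (induction f rule: laurent_induct)
       (simp_all add: permute_vars_0 permute_vars_add distrib_right single)
qed

lemma permute_vars_Const: "permute_vars p (Const c) = Const c"
  using permutes_inj[OF permutes_inv[OF p]] by (simp add: Const_def permute_vars_single)

lemma permute_vars_prod: "permute_vars p (prod g B) = (\<Prod>b\<in>B. permute_vars p (g b))"
  using permute_vars_Const[of 1]
  by (induction B rule: infinite_finite_induct) (auto simp: Const_simps permute_vars_mult)

end

lemma symmetric_iff: "symmetric n f \<longleftrightarrow> (\<forall>p. p permutes {1..n} \<longrightarrow> permute_vars p f = f)"
  unfolding symmetric_def poly_mapping_eq_iff fun_eq_iff
  by (auto simp: lookup_permute_vars)

section \<open>Linear combinations\<close>

definition lincomb :: "'i set \<Rightarrow> ('i \<Rightarrow> 'f::field laurent) \<Rightarrow> 'f laurent set" where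
  "lincomb I g = {f. \<exists>A c. finite A \<and> A \<subseteq> I \<and> f = (\<Sum>e\<in>A. Const (c e) * g e)}"

lemma lincomb_superset:
  assumes "finite B" "A \<subseteq> B"
  shows "(\<Sum>e\<in>A. Const (c e) * g e) = (\<Sum>e\<in>B. Const (if e \<in> A then c e else 0) * g e)"
  using assms by (intro sum.mono_neutral_cong_left) (auto simp: Const_simps)

lemma lincomb_0: "0 \<in> lincomb I g"
  unfolding lincomb_def by (auto intro!: exI[of _ "{}"])

lemma lincomb_base: "e \<in> I \<Longrightarrow> g e \<in> lincomb I g"
  unfolding lincomb_def by (auto intro!: exI[of _ "{e}"] exI[of _ "\<lambda>_. 1"] simp: Const_simps)

lemma lincomb_add:
  assumes "f \<in> lincomb I g" "f' \<in> lincomb I g"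
  shows "f + f' \<in> lincomb I g"
proof -
  obtain A A' c c' where A: "finite A" "A \<subseteq> I" "finite A'" "A' \<subseteq> I"
    and f: "f = (\<Sum>e\<in>A. Const (c e) * g e)" "f' = (\<Sum>e\<in>A'. Const (c' e) * g e)"
    using assms unfolding lincomb_def by blast
  have "f + f' = (\<Sum>e\<in>A \<union> A'. Const (if e \<in> A then c e else 0) * g e)
      + (\<Sum>e\<in>A \<union> A'. Const (if e \<in> A' then c' e else 0) * g e)"
    unfolding f using A by (intro arg_cong2[of _ _ _ _ "(+)"] lincomb_superset) auto
  then have "f + f' = (\<Sum>e\<in>A \<union> A'. Const ((if e \<in> A then c e else 0) + (if e \<in> A' then c' e else 0)) * g e)"
    by (simp only: Const_simps(3) distrib_right sum.distrib)
  moreover have "finite (A \<union> A')" "A \<union> A' \<subseteq> I" using A by auto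
  ultimately show ?thesis unfolding lincomb_def mem_Collect_eq
    by (intro exI[of _ "A \<union> A'"]
        exI[of _ "\<lambda>e. (if e \<in> A then c e else 0) + (if e \<in> A' then c' e else 0)"] conjI)
qed

lemma lincomb_Const_mult: "f \<in> lincomb I g \<Longrightarrow> Const a * f \<in> lincomb I g"
proof -
  assume "f \<in> lincomb I g"
  then obtain A c where A: "finite A" "A \<subseteq> I" "f = (\<Sum>e\<in>A. Const (c e) * g e)"
    unfolding lincomb_def by blast
  then have "Const a * f = (\<Sum>e\<in>A. Const (a * c e) * g e)"
    by (simp add: sum_distrib_left Const_simps mult.assoc)
  with A(1,2) show ?thesis unfolding lincomb_def mem_Collect_eq
    by (intro exI[of _ A] exI[of _ "\<lambda>e. a * c e"] conjI)
qed

lemma lincomb_sum: "(\<And>a. a \<in> A \<Longrightarrow> h a \<in> lincomb I g) \<Longrightarrow> sum h A \<in> lincomb I g"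
  by (induction A rule: infinite_finite_induct) (auto intro: lincomb_0 lincomb_add)

lemma lincomb_mult_closed:
  assumes "f \<in> lincomb I g" "\<And>e. e \<in> I \<Longrightarrow> x * g e \<in> lincomb J h"
  shows "x * f \<in> lincomb J h"
proof -
  obtain A c where A: "finite A" "A \<subseteq> I" and f: "f = (\<Sum>e\<in>A. Const (c e) * g e)"
    using assms(1) unfolding lincomb_def by blast
  have "x * f = (\<Sum>e\<in>A. Const (c e) * (x * g e))"
    by (simp add: f sum_distrib_left mult.left_commute)
  then show ?thesis using A(2) assms(2) by (auto intro!: lincomb_sum lincomb_Const_mult)
qed

lemma lincomb_finite:
  assumes "finite I" "f \<in> lincomb I g"
  shows "\<exists>c. f = (\<Sum>e\<in>I. Const (c e) * g e)"
proof -
  obtain A c where "A \<subseteq> I" "f = (\<Sum>e\<in>A. Const (c e) * g e)"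
    using assms(2) unfolding lincomb_def by blast
  then have "f = (\<Sum>e\<in>I. Const (if e \<in> A then c e else 0) * g e)"
    using lincomb_superset[OF assms(1)] by simp
  then show ?thesis by (rule exI[of _ "\<lambda>e. if e \<in> A then c e else 0"])
qed

lemma laurent_eval_lincomb:
  assumes "\<And>e. e \<in> A \<Longrightarrow> evaluable x (g e)"
  shows "laurent_eval (\<Sum>e\<in>A. Const (c e) * g e) x = (\<Sum>e\<in>A. c e * laurent_eval (g e) x)"
  using assms unfolding laurent_eval_sum
  by (intro sum.cong) (auto simp: laurent_eval_mult evaluable_Const laurent_eval_Const)

section \<open>Newton bases of the rings of the families\<close>

text \<open>The common features of the four families. The generators are the values at \<open>x\<^sub>i\<close> of one univariate
  Laurent polynomial \<open>\<Sum>\<^bsub>s\<in>T\<^esub> c\<^sub>s x\<^sup>s\<close> with leading monomial \<open>x\<^sup>k\<close>, where \<open>k = fam_deg F\<close> is the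
  factor in the degree bound. There is a specialisation of the parameters after which the generator
  \<open>y\<^sub>i\<close> takes at the node of \<open>l\<close> a value \<open>u (l i)\<close> that depends on neither \<open>i\<close> nor the other parts of
  \<open>l\<close> and increases strictly with \<open>l i\<close>.\<close>

locale interpolation_family = specialization sp
  for sp :: "'f::field \<Rightarrow> rat \<Rightarrow> bool" +
  fixes F :: "'f family" and n :: nat and T :: "int set" and c :: "int \<Rightarrow> 'f" and u :: "nat \<Rightarrow> rat"
  assumes n_pos: "1 \<le> n"
    and gen: "fam_gen F i = (\<Sum>s\<in>T. Poly_Mapping.single (Poly_Mapping.single i s) (c s))"
    and finite_T: "finite T"
    and T_bounds: "s \<in> T \<Longrightarrow> \<bar>s\<bar> \<le> int (fam_deg F)"
    and top_T: "int (fam_deg F) \<in> T" "c (int (fam_deg F)) = 1"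
    and deg_pos: "0 < fam_deg F"
    and shift_nonzero: "s \<in> T \<Longrightarrow> s < 0 \<Longrightarrow> fam_shift F n l i \<noteq> 0"
    and sp_node: "i \<in> {1..n} \<Longrightarrow> sp (laurent_eval (fam_gen F i) (fam_shift F n l)) (u (l i))"
    and strict_mono_u: "strict_mono u"
begin

abbreviation eval :: "'f laurent \<Rightarrow> (nat \<Rightarrow> nat) \<Rightarrow> 'f" where
  "eval f l \<equiv> laurent_eval f (fam_shift F n l)"

abbreviation alg :: "'f laurent set" where
  "alg \<equiv> subalgebra_gen (fam_gen F ` {1..n})"

text \<open>Lifts of the numbers \<open>u r\<close> to the base field, found among the values of the generators.\<close>

definition base :: "nat \<Rightarrow> 'f" where
  "base r = eval (fam_gen F 1) (\<lambda>_. r)"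

definition newton :: "nat \<Rightarrow> nat \<Rightarrow> 'f laurent" where
  "newton i m = (\<Prod>r<m. fam_gen F i - Const (base r))"

text \<open>With \<open>y\<^sub>i\<close> for the generators, this is \<open>\<Prod>\<^sub>i \<Prod>\<^bsub>r<e(i)\<^esub> (y\<^sub>i - base r)\<close>, the Newton counterpart of the
  monomial with exponent vector \<open>e\<close>.\<close>

definition newton_prod :: "(nat \<Rightarrow> nat) \<Rightarrow> 'f laurent" where
  "newton_prod e = (\<Prod>i=1..n. newton i (e i))"

text \<open>Summing over permutations rather than over rearrangements counts each rearrangement as often as the
  stabiliser of \<open>e\<close> has elements; in characteristic 0 this does not affect the span.\<close>

definition orbit_sum :: "(nat \<Rightarrow> nat) \<Rightarrow> 'f laurent" where
  "orbit_sum e = (\<Sum>p | p permutes {1..n}. newton_prod (e \<circ> p))"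

text \<open>The specialisation of the value of \<open>orbit_sum e\<close> at the node of \<open>l\<close>.\<close>

definition orbit_value :: "(nat \<Rightarrow> nat) \<Rightarrow> (nat \<Rightarrow> nat) \<Rightarrow> rat" where
  "orbit_value e l = (\<Sum>p | p permutes {1..n}. \<Prod>i=1..n. \<Prod>r<e (p i). u (l i) - u r)"

lemma finite_permutations_n: "finite {p. p permutes {1..n}}"
  by (simp add: finite_permutations)

lemma keys_gen: "m \<in> Poly_Mapping.keys (fam_gen F i) \<Longrightarrow> \<exists>s\<in>T. m = Poly_Mapping.single i s"
proof -
  assume "m \<in> Poly_Mapping.keys (fam_gen F i)"
  then have "m \<in> (\<Union>s\<in>T. Poly_Mapping.keys (Poly_Mapping.single (Poly_Mapping.single i s) (c s)))"
    unfolding gen by (rule subsetD[OF keys_sum])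
  then obtain s where "s \<in> T"
      "m \<in> Poly_Mapping.keys (Poly_Mapping.single (Poly_Mapping.single i s) (c s))"
    by (rule UN_E)
  then show ?thesis by (intro bexI[of _ s]) (simp_all split: if_splits)
qed

lemma alg_evaluable: "f \<in> alg \<Longrightarrow> evaluable (fam_shift F n l) f"
proof (erule evaluable_subalgebra)
  fix g assume "g \<in> fam_gen F ` {1..n}"
  then obtain i where g: "g = fam_gen F i" by blast
  show "evaluable (fam_shift F n l) g"
    unfolding evaluable_def g
    by (auto dest!: keys_gen simp: Poly_Mapping.lookup_single when_def shift_nonzero split: if_splits)
qed

lemma alg_1: "1 \<in> alg"
  using subalgebra_gen.const[of 1] by (simp add: Const_simps)

lemma alg_0: "0 \<in> alg"
  using subalgebra_gen.const[of 0] by (simp add: Const_simps)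

lemma alg_sum: "(\<And>a. a \<in> A \<Longrightarrow> g a \<in> alg) \<Longrightarrow> sum g A \<in> alg"
  by (induction A rule: infinite_finite_induct) (auto intro: alg_0 subalgebra_gen.add simp del: One_nat_def)

lemma alg_prod: "(\<And>a. a \<in> A \<Longrightarrow> g a \<in> alg) \<Longrightarrow> prod g A \<in> alg"
  by (induction A rule: infinite_finite_induct) (auto intro: alg_1 subalgebra_gen.mult simp del: One_nat_def)

lemma alg_factor: "i \<in> {1..n} \<Longrightarrow> fam_gen F i - Const a \<in> alg"
  using subalgebra_gen.add[OF subalgebra_gen.gen subalgebra_gen.const, of "fam_gen F i" _ "- a"]
  by (simp add: Const_simps)

lemma newton_alg: "i \<in> {1..n} \<Longrightarrow> newton i m \<in> alg"
  unfolding newton_def by (intro alg_prod alg_factor)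

lemma newton_prod_alg: "newton_prod e \<in> alg"
  unfolding newton_prod_def by (intro alg_prod newton_alg)

lemma orbit_sum_alg: "orbit_sum e \<in> alg"
  unfolding orbit_sum_def by (intro alg_sum newton_prod_alg)

lemma eval_factor: "eval (fam_gen F i - Const a) l = eval (fam_gen F i) l - a"
proof -
  have "fam_gen F i - Const a = fam_gen F i + Const (- a)" by (simp add: Const_simps)
  then show ?thesis by (simp only: laurent_eval_add laurent_eval_Const diff_conv_add_uminus)
qed

lemma eval_newton_prod:
  "eval (newton_prod e) l = (\<Prod>i=1..n. \<Prod>r<e i. eval (fam_gen F i) l - base r)"
  unfolding newton_prod_def
proof (subst laurent_eval_prod[THEN conjunct2])
  show "evaluable (fam_shift F n l) (newton i (e i))" if "i \<in> {1..n}" for i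
    by (rule alg_evaluable[OF newton_alg[OF that]])
  show "(\<Prod>i=1..n. eval (newton i (e i)) l) = (\<Prod>i=1..n. \<Prod>r<e i. eval (fam_gen F i) l - base r)"
  proof (rule prod.cong[OF refl])
    fix i assume i: "i \<in> {1..n}"
    have "eval (newton i (e i)) l = (\<Prod>r<e i. eval (fam_gen F i - Const (base r)) l)"
      unfolding newton_def
      by (rule laurent_eval_prod[THEN conjunct2]) (intro alg_evaluable alg_factor i)
    then show "eval (newton i (e i)) l = (\<Prod>r<e i. eval (fam_gen F i) l - base r)"
      by (simp add: eval_factor)
  qed
qed

lemma sp_base: "sp (base r) (u r)"
  using sp_node[of 1 "\<lambda>_. r"] n_pos by (simp add: base_def)

lemma sp_orbit_sum: "sp (eval (orbit_sum e) l) (orbit_value e l)"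
  unfolding orbit_sum_def orbit_value_def laurent_eval_sum eval_newton_prod comp_def
  by (intro sp_sum sp_prod sp_diff sp_node sp_base)

lemma laurent_degree_newton_prod: "laurent_degree (newton_prod e) \<le> fam_deg F * weight n e"
proof -
  have "abs_degree m \<le> fam_deg F" if "m \<in> Poly_Mapping.keys (fam_gen F i)" for i m
    using keys_gen[OF that] T_bounds by (force simp: abs_degree_single)
  then have "laurent_degree (fam_gen F i) \<le> fam_deg F" for i
    by (simp add: laurent_degree_le_iff)
  then have "laurent_degree (fam_gen F i + Const (- a)) \<le> fam_deg F" for i a
    by (intro laurent_degree_add laurent_degree_Const)
  then have "laurent_degree (fam_gen F i - Const a) \<le> fam_deg F" for i a
    by (simp add: Const_simps)
  then have "laurent_degree (newton i m) \<le> (\<Sum>r<m. fam_deg F)" for i m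
    unfolding newton_def by (intro laurent_degree_prod)
  then have "laurent_degree (newton i m) \<le> fam_deg F * m" for i m
    by (simp add: mult.commute)
  then have "laurent_degree (newton_prod e) \<le> (\<Sum>i=1..n. fam_deg F * e i)"
    unfolding newton_prod_def by (intro laurent_degree_prod)
  then show ?thesis by (simp add: weight_def sum_distrib_left)
qed

text \<open>Arranged as a sum over the factors of \<open>newton_prod e\<close>, each of which contributes its leading
  exponent.\<close>

definition top_exp :: "(nat \<Rightarrow> nat) \<Rightarrow> nat \<Rightarrow>\<^sub>0 int" where
  "top_exp e = (\<Sum>i=1..n. \<Sum>r<e i. Poly_Mapping.single i (int (fam_deg F)))"

lemma monic_newton_prod: "monic_at (top_exp e) (newton_prod e)"
proof -
  have "monic_at (Poly_Mapping.single i (int (fam_deg F))) (fam_gen F i - Const a)" for i a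
    unfolding monic_at_def
  proof (intro exI conjI ballI)
    let ?g = "(\<Sum>s\<in>T - {int (fam_deg F)}. Poly_Mapping.single (Poly_Mapping.single i s) (c s)) + Const (- a)"
    show "fam_gen F i - Const a
        = Poly_Mapping.single (Poly_Mapping.single i (int (fam_deg F))) 1 + ?g"
      using finite_T top_T unfolding gen by (subst sum.remove[OF _ top_T(1)]) (simp_all add: Const_simps)
    fix m assume "m \<in> Poly_Mapping.keys ?g"
    then have "(\<exists>s\<in>T - {int (fam_deg F)}. m = Poly_Mapping.single i s) \<or> m = 0"
      using subsetD[OF keys_add, of m "\<Sum>s\<in>T - {int (fam_deg F)}. Poly_Mapping.single (Poly_Mapping.single i s) (c s)"]
        subsetD[OF keys_sum, of m "\<lambda>s. Poly_Mapping.single (Poly_Mapping.single i s) (c s)"]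
      by (fastforce simp: Const_def split: if_splits)
    then show "signed_degree m < signed_degree (Poly_Mapping.single i (int (fam_deg F)))"
    proof (elim disjE bexE)
      fix s assume s: "s \<in> T - {int (fam_deg F)}" "m = Poly_Mapping.single i s"
      then show ?thesis using T_bounds[of s] by (auto simp: signed_degree_single)
    qed (use deg_pos in \<open>simp add: signed_degree_single signed_degree_def[of 0]\<close>)
  qed
  then show ?thesis
    unfolding top_exp_def newton_prod_def newton_def by (intro monic_at_prod)
qed

lemma lookup_top_exp:
  "Poly_Mapping.lookup (top_exp e) i = (if i \<in> {1..n} then int (fam_deg F * e i) else 0)"
proof -
  have "Poly_Mapping.lookup (top_exp e) i
      = (\<Sum>j=1..n. if j = i then int (fam_deg F * e i) else 0)"
    unfolding top_exp_def lookup_sum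
    by (intro sum.cong) (auto simp: Poly_Mapping.lookup_single)
  also have "\<dots> = (if i \<in> {1..n} then int (fam_deg F * e i) else 0)"
    by (subst sum.delta) auto
  finally show ?thesis .
qed

lemma signed_degree_top_exp: "signed_degree (top_exp e) = int (fam_deg F * weight n e)"
proof -
  have "Poly_Mapping.keys (top_exp e) \<subseteq> {1..n}"
    by (auto simp: in_keys_iff lookup_top_exp split: if_splits)
  then show ?thesis
    by (subst signed_degree_superset[of "{1..n}"])
       (auto simp: lookup_top_exp weight_def sum_distrib_left)
qed

lemma top_exp_inject: "e \<in> exps n \<Longrightarrow> e' \<in> exps n \<Longrightarrow> top_exp e = top_exp e' \<Longrightarrow> e = e'"
proof (rule ext)
  fix i assume e: "e \<in> exps n" "e' \<in> exps n" "top_exp e = top_exp e'"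
  show "e i = e' i"
  proof (cases "i \<in> {1..n}")
    case True
    with lookup_top_exp[of e i] lookup_top_exp[of e' i] e(3) deg_pos show ?thesis by simp
  qed (use e in \<open>auto simp: exps_def\<close>)
qed

text \<open>The span of the Newton products is stable under multiplication by a generator, since
  \<open>y\<^sub>i N\<^sub>e = N\<^bsub>e'\<^esub> + base (e i) N\<^sub>e\<close> where \<open>e'\<close> is \<open>e\<close> with \<open>e i\<close> increased by 1.\<close>

lemma alg_lincomb_newton:
  assumes "f \<in> alg"
  shows "f \<in> lincomb (exps n) newton_prod"
proof -
  have "\<forall>g\<in>lincomb (exps n) newton_prod. f * g \<in> lincomb (exps n) newton_prod"
    using assms
  proof induction
    case (gen f)
    then obtain i where i: "i \<in> {1..n}" and f: "f = fam_gen F i" by blast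
    have "f * newton_prod e \<in> lincomb (exps n) newton_prod" if e: "e \<in> exps n" for e
    proof -
      let ?e = "e(i := Suc (e i))"
      have split: "newton_prod e' = newton i (e' i) * (\<Prod>j\<in>{1..n}-{i}. newton j (e' j))" for e'
        unfolding newton_prod_def using i by (subst prod.remove[of _ i]) auto
      have "newton_prod ?e = (f - Const (base (e i))) * newton_prod e"
        unfolding split[of ?e] split[of e] f by (simp add: newton_def algebra_simps)
      then have "f * newton_prod e = newton_prod ?e + Const (base (e i)) * newton_prod e"
        by (simp add: algebra_simps)
      moreover have "?e \<in> exps n" using e i by (auto simp: exps_def)
      ultimately show ?thesis
        using e by (auto intro: lincomb_add lincomb_Const_mult lincomb_base)
    qed
    then show ?case by (blast intro: lincomb_mult_closed)
  qed (auto simp: lincomb_Const_mult distrib_right mult.assoc intro: lincomb_add)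
  moreover have "newton_prod (\<lambda>_. 0) = 1" by (simp add: newton_prod_def newton_def)
  then have "1 \<in> lincomb (exps n) newton_prod"
    using lincomb_base[of "\<lambda>_. 0" "exps n" newton_prod] by (simp add: exps_def)
  ultimately show ?thesis by force
qed

text \<open>The degree bound of a combination of Newton products can be read off term by term: the leading
  exponent of a term of maximal weight occurs in no other term of the combination, hence survives, and
  all its entries are nonnegative.\<close>

lemma alg_degree_lincomb_newton:
  assumes "f \<in> alg" and deg: "laurent_degree f \<le> fam_deg F * d"
  shows "f \<in> lincomb {e \<in> exps n. weight n e \<le> d} newton_prod"
proof -
  obtain A b where A: "finite A" "A \<subseteq> exps n" and f: "f = (\<Sum>e\<in>A. Const (b e) * newton_prod e)"
    using alg_lincomb_newton[OF assms(1)] unfolding lincomb_def by blast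
  define A' where "A' = {e \<in> A. b e \<noteq> 0}"
  have A': "finite A'" "A' \<subseteq> exps n" using A by (auto simp: A'_def)
  have f': "f = (\<Sum>e\<in>A'. Const (b e) * newton_prod e)"
    unfolding f A'_def using A(1)
    by (intro sum.mono_neutral_right) (auto simp: Const_simps)
  have "weight n e \<le> d" if "e \<in> A'" for e
  proof -
    have "Max (weight n ` A') \<in> weight n ` A'" using A'(1) that by (intro Max_in) auto
    then obtain e0 where e0: "e0 \<in> A'" "weight n e0 = Max (weight n ` A')" by (metis imageE)
    have max: "weight n e' \<le> weight n e0" if "e' \<in> A'" for e'
      using e0 A'(1) that by simp
    have "Poly_Mapping.lookup (newton_prod e') (top_exp e0) = (if e' = e0 then 1 else 0)"
      if "e' \<in> A'" for e'
    proof (subst monic_at_lookup[OF monic_newton_prod])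
      show "signed_degree (top_exp e') \<le> signed_degree (top_exp e0)"
        unfolding signed_degree_top_exp of_nat_le_iff using max[OF that] by simp
      show "(if top_exp e0 = top_exp e' then 1 else 0) = (if e' = e0 then 1 else (0::'f))"
        using top_exp_inject[of e0 e'] that e0(1) A'(2) by auto
    qed
    then have "Poly_Mapping.lookup f (top_exp e0) = (\<Sum>e'\<in>A'. if e' = e0 then b e' else 0)"
      unfolding f' lookup_sum lookup_Const_mult by (intro sum.cong) auto
    also have "\<dots> = b e0" using A'(1) e0(1) by simp
    finally have "top_exp e0 \<in> Poly_Mapping.keys f"
      using e0(1) by (simp add: in_keys_iff A'_def)
    then have "abs_degree (top_exp e0) \<le> fam_deg F * d"
      using deg by (simp add: laurent_degree_le_iff)
    then have "int (fam_deg F * weight n e0) \<le> int (fam_deg F * d)"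
      using signed_degree_le[of "top_exp e0"] unfolding signed_degree_top_exp by linarith
    then have "weight n e0 \<le> d" using deg_pos unfolding of_nat_le_iff by simp
    then show ?thesis using max[OF that] by simp
  qed
  then have "newton_prod e \<in> lincomb {e \<in> exps n. weight n e \<le> d} newton_prod" if "e \<in> A'" for e
    using A'(2) that by (intro lincomb_base) auto
  then show ?thesis unfolding f' by (intro lincomb_sum lincomb_Const_mult)
qed

lemma permute_vars_newton_prod:
  assumes p: "p permutes {1..n}"
  shows "permute_vars p (newton_prod e) = newton_prod (e \<circ> inv p)"
proof -
  have gen': "permute_vars p (fam_gen F i - Const a) = fam_gen F (p i) - Const a" for i a
  proof -
    have "permute_vars p (fam_gen F i + Const (- a)) = fam_gen F (p i) + Const (- a)"
      unfolding gen permute_vars_add[OF p] permute_vars_sum[OF p] permute_vars_single_var[OF p]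
        permute_vars_Const[OF p] ..
    then show ?thesis by (simp add: Const_simps)
  qed
  have "permute_vars p (newton_prod e) = (\<Prod>i=1..n. newton (p i) (e i))"
    by (simp add: newton_prod_def newton_def permute_vars_prod[OF p] gen')
  also have "\<dots> = (\<Prod>i=1..n. newton (p i) ((e \<circ> inv p) (p i)))"
    using permutes_inverses[OF p] by simp
  also have "\<dots> = newton_prod (e \<circ> inv p)"
    unfolding newton_prod_def
    using prod.permute[OF p, of "\<lambda>i. newton i ((e \<circ> inv p) i)"] by (simp add: comp_def)
  finally show ?thesis .
qed

lemma orbit_sum_permute:
  assumes "p permutes {1..n}"
  shows "orbit_sum (e \<circ> p) = orbit_sum e"
  unfolding orbit_sum_def comp_assoc
  by (rule sum.reindex_bij_witness[of _ "\<lambda>q. inv p \<circ> q" "\<lambda>q. p \<circ> q"])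
     (auto intro: permutes_compose permutes_inv assms
       simp: comp_assoc[symmetric] permutes_inv_o[OF assms] simp del: One_nat_def)

lemma orbit_sum_Lam: "orbit_sum e \<in> Lam F n"
proof -
  have "permute_vars p (orbit_sum e) = orbit_sum e" if p: "p permutes {1..n}" for p
  proof -
    have "permute_vars p (orbit_sum e) = (\<Sum>q | q permutes {1..n}. newton_prod (e \<circ> (q \<circ> inv p)))"
      by (simp add: orbit_sum_def permute_vars_sum[OF p] permute_vars_newton_prod[OF p] comp_assoc)
    also have "\<dots> = orbit_sum e"
      unfolding orbit_sum_def
      by (rule sum.reindex_bij_witness[of _ "\<lambda>q. q \<circ> p" "\<lambda>q. q \<circ> inv p"])
         (auto intro: permutes_compose permutes_inv p
           simp: comp_assoc permutes_inv_o[OF p] simp del: One_nat_def)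
    finally show ?thesis .
  qed
  then show ?thesis using orbit_sum_alg by (simp add: Lam_def symmetric_iff del: One_nat_def)
qed

lemma laurent_degree_orbit_sum: "laurent_degree (orbit_sum e) \<le> fam_deg F * weight n e"
  unfolding orbit_sum_def
  using laurent_degree_newton_prod weight_permute[of _ n e]
  by (intro laurent_degree_sum) (metis mem_Collect_eq)

text \<open>A symmetric element is the average of its images under the permutations, and averaging turns a
  Newton product into a multiple of an orbit sum. The division by the number of permutations is
  possible because that number specialises to itself, hence is nonzero in the base field.\<close>

lemma Lam_degree_lincomb_orbit_sum:
  assumes f: "f \<in> Lam F n" and deg: "laurent_degree f \<le> fam_deg F * d"
  shows "\<exists>b. f = (\<Sum>e\<in>parts_upto n d. Const (b e) * orbit_sum e)"
proof -
  let ?P = "{p. p permutes {1..n}}"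
  obtain A b where A: "finite A" "A \<subseteq> {e \<in> exps n. weight n e \<le> d}"
    and feq: "f = (\<Sum>e\<in>A. Const (b e) * newton_prod e)"
    using alg_degree_lincomb_newton[OF _ deg] f unfolding lincomb_def Lam_def by blast
  have orbit: "orbit_sum e = (\<Sum>p\<in>?P. newton_prod (e \<circ> inv p))" for e
    unfolding orbit_sum_def
    by (rule sum.reindex_bij_witness[of _ inv inv]) (auto simp: permutes_inv permutes_inv_inv)
  have "of_nat (card ?P) * f = (\<Sum>p\<in>?P. permute_vars p f)"
    using f by (simp add: Lam_def symmetric_iff)
  also have "\<dots> = (\<Sum>p\<in>?P. \<Sum>e\<in>A. Const (b e) * newton_prod (e \<circ> inv p))"
    unfolding feq
    by (intro sum.cong refl)
       (simp add: permute_vars_sum permute_vars_mult permute_vars_Const permute_vars_newton_prod)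
  also have "\<dots> = (\<Sum>e\<in>A. Const (b e) * orbit_sum e)"
    unfolding orbit sum_distrib_left by (rule sum.swap)
  finally have sum_perm: "of_nat (card ?P) * f = (\<Sum>e\<in>A. Const (b e) * orbit_sum e)" .
  have "card ?P > 0" using finite_permutations_n permutes_id[of "{1..n}"] unfolding card_gt_0_iff by blast
  then have "of_nat (card ?P) \<noteq> (0::'f)"
    using sp_nonzero[OF sp_of_nat] by simp
  moreover have "of_nat m = Const (of_nat m :: 'f)" for m
    by (simp add: Const_def)
  ultimately have "f = Const (1 / of_nat (card ?P)) * (of_nat (card ?P) * f)"
    by (simp add: mult.assoc[symmetric] Const_simps(4)[symmetric] Const_simps(2))
  also have "\<dots> \<in> lincomb (parts_upto n d) orbit_sum"
    unfolding sum_perm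
  proof (intro lincomb_Const_mult lincomb_sum)
    fix e assume e: "e \<in> A"
    then obtain p where p: "p permutes {1..n}" "e \<circ> p \<in> parts n"
      using ex_permute_parts A(2) by blast
    then have "e \<circ> p \<in> parts_upto n d"
      using A(2) e weight_permute[OF p(1), of e] by (auto simp: parts_upto_def)
    from lincomb_base[OF this, of orbit_sum]
    show "orbit_sum e \<in> lincomb (parts_upto n d) orbit_sum"
      by (simp add: orbit_sum_permute[OF p(1)])
  qed
  finally show ?thesis by (rule lincomb_finite[OF finite_parts_upto])
qed

lemma node_prod_pos: "m \<le> a \<Longrightarrow> 0 < (\<Prod>r<m. u a - u r)"
  using strict_mono_u by (intro prod_pos) (auto simp: strict_mono_def)

lemma node_prod_zero: "a < m \<Longrightarrow> (\<Prod>r<m. u a - u r) = 0"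
  by (intro prod_zero) auto

lemma node_prod_nonneg: "0 \<le> (\<Prod>r<m. u a - u r)"
  using node_prod_pos[of m a] node_prod_zero[of a m] by linarith

text \<open>All terms are nonnegative because \<open>u\<close> is increasing, and the term of the identity is positive.\<close>

lemma orbit_value_pos:
  assumes "\<And>i. i \<in> {1..n} \<Longrightarrow> e i \<le> l i"
  shows "0 < orbit_value e l"
  unfolding orbit_value_def
proof (rule sum_pos2[OF finite_permutations_n])
  show "id \<in> {p. p permutes {1..n}}" using permutes_id[of "{1..n}"] by blast
  show "0 < (\<Prod>i=1..n. \<Prod>r<e (id i). u (l i) - u r)"
    using assms by (intro prod_pos[where f = "\<lambda>i. \<Prod>r<e (id i). u (l i) - u r"])
      (simp add: node_prod_pos del: prod_pos)
qed (intro prod_nonneg ballI node_prod_nonneg)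

lemma orbit_value_nonzero:
  assumes "orbit_value e l \<noteq> 0"
  obtains p where "p permutes {1..n}" "\<And>i. i \<in> {1..n} \<Longrightarrow> e (p i) \<le> l i"
proof -
  obtain p where p: "p permutes {1..n}" and nz: "(\<Prod>i=1..n. \<Prod>r<e (p i). u (l i) - u r) \<noteq> 0"
    using sum.not_neutral_contains_not_neutral[OF assms[unfolded orbit_value_def]] by auto
  have "e (p i) \<le> l i" if "i \<in> {1..n}" for i
  proof (rule ccontr)
    assume "\<not> e (p i) \<le> l i"
    then have "(\<Prod>r<e (p i). u (l i) - u r) = 0" by (intro node_prod_zero) simp
    with that have "(\<Prod>i=1..n. \<Prod>r<e (p i). u (l i) - u r) = 0"
      by (intro prod_zero) blast+
    then show False using nz by simp
  qed
  with p show ?thesis by (rule that)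
qed

text \<open>If the value is nonzero, some rearrangement of \<open>e\<close> lies below \<open>l\<close>; it can have the weight of \<open>l\<close> only
  if it equals \<open>l\<close>, and two partitions that are rearrangements of each other coincide.\<close>

lemma orbit_value_triangular:
  assumes "e \<in> parts n" "l \<in> parts n" "orbit_value e l \<noteq> 0" "e \<noteq> l"
  shows "weight n e < weight n l"
proof -
  obtain p where p: "p permutes {1..n}" and le: "\<And>i. i \<in> {1..n} \<Longrightarrow> e (p i) \<le> l i"
    using orbit_value_nonzero[OF assms(3)] by blast
  have "e \<circ> p \<noteq> l" using parts_permute_unique[OF assms(2,1) p] assms(4) by auto
  moreover have "(e \<circ> p) i = l i" if "i \<notin> {1..n}" for i
    using exps_permute[OF parts_exps[OF assms(1)] p] assms(2) that by (auto simp: exps_def parts_def)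
  ultimately obtain i where "i \<in> {1..n}" "(e \<circ> p) i \<noteq> l i" by blast
  then have "weight n (e \<circ> p) < weight n l"
    unfolding weight_def using le by (intro sum_strict_mono_ex1) (auto simp: less_le)
  then show ?thesis by (simp add: weight_permute[OF p])
qed

section \<open>Unique solvability of the interpolation problem\<close>

lemma Lam_0: "0 \<in> Lam F n"
  using alg_0 by (simp add: Lam_def symmetric_iff permute_vars_0 del: One_nat_def)

lemma Lam_add: "f \<in> Lam F n \<Longrightarrow> g \<in> Lam F n \<Longrightarrow> f + g \<in> Lam F n"
  using subalgebra_gen.add[of f _ g] by (simp add: Lam_def symmetric_iff permute_vars_add del: One_nat_def)

lemma Lam_mult: "f \<in> Lam F n \<Longrightarrow> g \<in> Lam F n \<Longrightarrow> f * g \<in> Lam F n"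
  using subalgebra_gen.mult[of f _ g] by (simp add: Lam_def symmetric_iff permute_vars_mult del: One_nat_def)

lemma Lam_Const_mult: "f \<in> Lam F n \<Longrightarrow> Const a * f \<in> Lam F n"
  using subalgebra_gen.const[of a]
  by (intro Lam_mult) (simp_all add: Lam_def symmetric_iff permute_vars_Const del: One_nat_def)

lemma Lam_sum: "(\<And>a. a \<in> A \<Longrightarrow> g a \<in> Lam F n) \<Longrightarrow> sum g A \<in> Lam F n"
  by (induction A rule: infinite_finite_induct) (auto intro: Lam_0 Lam_add)

lemma Lam_evaluable: "f \<in> Lam F n \<Longrightarrow> evaluable (fam_shift F n l) f"
  using alg_evaluable by (simp add: Lam_def)

lemma eval_mult: "f \<in> Lam F n \<Longrightarrow> g \<in> Lam F n \<Longrightarrow> eval (f * g) l = eval f l * eval g l"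
  by (simp add: laurent_eval_mult Lam_evaluable)

lemma eval_lincomb:
  "(\<And>e. e \<in> A \<Longrightarrow> g e \<in> Lam F n) \<Longrightarrow>
     eval (\<Sum>e\<in>A. Const (b e) * g e) l = (\<Sum>e\<in>A. eval (g e) l * b e)"
  by (subst laurent_eval_lincomb) (simp_all add: Lam_evaluable mult.commute)

lemma interpolation_exists:
  "\<exists>f\<in>Lam F n. laurent_degree f \<le> fam_deg F * d \<and> (\<forall>l\<in>parts_upto n d. eval f l = b l)"
proof -
  have "orbit_value l l \<noteq> 0" for l
    using orbit_value_pos[of l l] by simp
  then have "\<exists>a. \<forall>l\<in>parts_upto n d. (\<Sum>e\<in>parts_upto n d. eval (orbit_sum e) l * a e) = b l"
    using orbit_value_triangular sp_orbit_sum
    by (intro triangular_system[where E' = "\<lambda>l e. orbit_value e l" and w = "weight n",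
          THEN conjunct1] finite_parts_upto)
       (auto simp: parts_upto_def)
  then obtain a where a: "\<And>l. l \<in> parts_upto n d \<Longrightarrow>
      (\<Sum>e\<in>parts_upto n d. eval (orbit_sum e) l * a e) = b l"
    by blast
  let ?f = "\<Sum>e\<in>parts_upto n d. Const (a e) * orbit_sum e"
  have "laurent_degree ?f \<le> fam_deg F * d"
    using laurent_degree_orbit_sum
    by (intro laurent_degree_sum laurent_degree_Const_mult)
       (auto simp: parts_upto_def intro: order_trans mult_le_mono2)
  moreover have "?f \<in> Lam F n" by (intro Lam_sum Lam_Const_mult orbit_sum_Lam)
  ultimately show ?thesis
    using a by (intro bexI[of _ ?f]) (auto simp: eval_lincomb orbit_sum_Lam)
qed

text \<open>The node \<open>pt l\<close> is the one that tests the coefficient of \<open>orbit_sum l\<close>. Both uniqueness statements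
  below arise from a choice of these nodes.\<close>

lemma vanishing_triangular:
  fixes w :: "(nat \<Rightarrow> nat) \<Rightarrow> nat"
  assumes f: "f \<in> Lam F n" "laurent_degree f \<le> fam_deg F * d"
    and zero: "\<And>l. l \<in> parts_upto n d \<Longrightarrow> eval f (pt l) = 0"
    and diag: "\<And>l. l \<in> parts_upto n d \<Longrightarrow> orbit_value l (pt l) \<noteq> 0"
    and tri: "\<And>l e. l \<in> parts_upto n d \<Longrightarrow> e \<in> parts_upto n d \<Longrightarrow> l \<noteq> e \<Longrightarrow>
      orbit_value e (pt l) \<noteq> 0 \<Longrightarrow> w e < w l"
  shows "f = 0"
proof -
  obtain b where b: "f = (\<Sum>e\<in>parts_upto n d. Const (b e) * orbit_sum e)"
    using Lam_degree_lincomb_orbit_sum[OF f] by blast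
  have "\<forall>l\<in>parts_upto n d. (\<Sum>e\<in>parts_upto n d. eval (orbit_sum e) (pt l) * b e) = 0"
    using zero unfolding b by (simp add: eval_lincomb orbit_sum_Lam)
  then have "\<forall>e\<in>parts_upto n d. b e = 0"
    using triangular_system[OF finite_parts_upto[of n d], of "\<lambda>l e. eval (orbit_sum e) (pt l)"
        "\<lambda>l e. orbit_value e (pt l)" w] sp_orbit_sum diag tri by blast
  then show ?thesis by (simp add: b Const_simps)
qed

lemma interpolation_unique:
  assumes "f \<in> Lam F n" "laurent_degree f \<le> fam_deg F * d"
    and "\<And>l. l \<in> parts_upto n d \<Longrightarrow> eval f l = 0"
  shows "f = 0"
proof (rule vanishing_triangular[OF assms(1,2), of "\<lambda>l. l" "weight n"])
  show "orbit_value l l \<noteq> 0" for l using orbit_value_pos[of l l] by simp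
qed (use assms(3) orbit_value_triangular in \<open>auto simp: parts_upto_def\<close>)

text \<open>The node of \<open>m\<close> may be replaced by the node of a partition covering \<open>m\<close> without destroying
  triangularity. This is what makes adjacent binomial coefficients nonzero.\<close>

lemma interpolation_unique_cover:
  assumes "l \<in> parts n" "m \<in> parts n" "covers n l m"
    and f: "f \<in> Lam F n" "laurent_degree f \<le> fam_deg F * weight n m"
    and "\<And>k. k \<in> parts_upto n (weight n m) \<Longrightarrow> k \<noteq> m \<Longrightarrow> eval f k = 0"
    and "eval f l = 0"
  shows "f = 0"
proof (rule vanishing_triangular[OF f])
  \<comment> \<open>The row of \<open>m\<close>, now evaluated at \<open>l\<close>, may meet every other column of weight at most that of \<open>m\<close>.
    Doubling the weights makes room to rank it after all other rows.\<close>
  let ?pt = "\<lambda>k. if k = m then l else k"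
  let ?w = "\<lambda>k. if k = m then 2 * weight n m + 1 else 2 * weight n k"
  show "eval f (?pt k) = 0" if "k \<in> parts_upto n (weight n m)" for k
    using that assms by simp
  show "orbit_value k (?pt k) \<noteq> 0" for k
    using orbit_value_pos[of k "?pt k"] assms(3) by (force simp: covers_def contains_def)
  fix k e assume *: "k \<in> parts_upto n (weight n m)" "e \<in> parts_upto n (weight n m)" "k \<noteq> e"
    "orbit_value e (?pt k) \<noteq> 0"
  then have parts: "k \<in> parts n" "e \<in> parts n" "weight n k \<le> weight n m" "weight n e \<le> weight n m"
    by (auto simp: parts_upto_def)
  show "?w e < ?w k"
  proof (cases "k = m")
    case True
    then show ?thesis using * parts by auto
  next
    case False
    then have "weight n e < weight n k"
      using orbit_value_triangular[of e k] * parts by auto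
    then show ?thesis using False parts by auto
  qed
qed

text \<open>Existence and uniqueness turn the definite description in \<open>interp_poly\<close> into its defining property.\<close>

lemma interp_poly:
  assumes m: "m \<in> parts n"
  shows interp_poly_Lam: "interp_poly F n m \<in> Lam F n"
    and interp_poly_degree: "laurent_degree (interp_poly F n m) \<le> fam_deg F * weight n m"
    and eval_interp_poly: "\<And>l. l \<in> parts n \<Longrightarrow> weight n l \<le> weight n m \<Longrightarrow>
      binom_coeff F n l m = (if l = m then 1 else 0)"
proof -
  let ?Q = "\<lambda>h. h \<in> Lam F n \<and> laurent_degree h \<le> fam_deg F * weight n m \<and>
        (\<forall>l\<in>parts n. weight n l \<le> weight n m \<longrightarrow> eval h l = (if l = m then 1 else 0))"
  have "\<exists>!h. ?Q h"
  proof (rule ex_ex1I)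
    show "\<exists>h. ?Q h"
      using interpolation_exists[of "weight n m" "\<lambda>l. if l = m then 1 else 0"]
      by (auto simp: parts_upto_def)
    fix f g assume fg: "?Q f" "?Q g"
    have eval: "eval (f + Const (- 1) * g) l = eval f l - eval g l" for l
      using fg by (simp add: laurent_eval_add laurent_eval_mult evaluable_Const Lam_evaluable
          laurent_eval_Const)
    have "f + Const (- 1) * g = 0"
      using fg
      by (intro interpolation_unique[of _ "weight n m"] Lam_add Lam_Const_mult laurent_degree_add
          laurent_degree_Const_mult) (auto simp: eval parts_upto_def)
    then show "f = g" by (simp add: Const_simps)
  qed
  then have "?Q (interp_poly F n m)" unfolding interp_poly_def by (rule theI')
  then show "interp_poly F n m \<in> Lam F n"
    and "laurent_degree (interp_poly F n m) \<le> fam_deg F * weight n m"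
    and "\<And>l. l \<in> parts n \<Longrightarrow> weight n l \<le> weight n m \<Longrightarrow>
      binom_coeff F n l m = (if l = m then 1 else 0)"
    unfolding binom_coeff_def by blast+
qed

text \<open>Otherwise the interpolation polynomial of \<open>m\<close> would vanish at the nodes of all other partitions of
  weight at most that of \<open>m\<close> and at the node of \<open>l\<close>, hence be zero, although it is 1 at the node of \<open>m\<close>.\<close>

lemma adj_binom_coeff_nonzero:
  assumes "l \<in> parts n" "m \<in> parts n" "covers n l m"
  shows "adj_binom_coeff F n l m \<noteq> 0"
proof
  assume "adj_binom_coeff F n l m = 0"
  then have "interp_poly F n m = 0"
    using eval_interp_poly[OF assms(2)]
    by (intro interpolation_unique_cover[OF assms interp_poly_Lam interp_poly_degree] assms)
       (auto simp: adj_binom_coeff_def binom_coeff_def parts_upto_def)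
  then have "binom_coeff F n m m = 0" by (simp add: binom_coeff_def laurent_eval_0)
  then show False using eval_interp_poly[OF assms(2,2)] by simp
qed

section \<open>Littlewood-Richardson coefficients\<close>

lemma binom_coeff_triangular:
  assumes "l \<in> parts n" "m \<in> parts n" "l \<noteq> m" "binom_coeff F n l m \<noteq> 0"
  shows "weight n m < weight n l"
  using eval_interp_poly[OF assms(2,1)] assms(3,4) by (cases "weight n l \<le> weight n m") auto

lemma binom_coeff_system:
  assumes "finite I" "I \<subseteq> parts n"
  shows "(\<exists>c. \<forall>l\<in>I. (\<Sum>m\<in>I. binom_coeff F n l m * c m) = b l) \<and>
    (\<forall>c. (\<forall>l\<in>I. (\<Sum>m\<in>I. binom_coeff F n l m * c m) = 0) \<longrightarrow> (\<forall>m\<in>I. c m = 0))"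
  using assms binom_coeff_triangular eval_interp_poly
  by (intro equality.triangular_system[where E' = "binom_coeff F n" and w = "weight n"])
     (auto simp: subset_iff)

text \<open>Interpolating the product at all nodes up to its degree by the \<open>h\<^sub>k\<close> gives existence of the expansion;
  uniqueness holds because the matrix of binomial coefficients is unitriangular. So the definite
  description in \<open>LR_coeff\<close> denotes this expansion.\<close>

lemma LR_expansion:
  assumes m: "m \<in> parts n" and v: "v \<in> parts n"
  obtains A where "finite A" "A \<subseteq> parts n" "\<And>l. l \<notin> A \<Longrightarrow> LR_coeff F n m v l = 0"
    "interp_poly F n m * interp_poly F n v =
      (\<Sum>k\<in>A. Const (LR_coeff F n m v k) * interp_poly F n k)"
proof -
  let ?h = "interp_poly F n"
  let ?Q = "\<lambda>c :: (nat \<Rightarrow> nat) \<Rightarrow>\<^sub>0 'f. Poly_Mapping.keys c \<subseteq> parts n \<and>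
    ?h m * ?h v = (\<Sum>k\<in>Poly_Mapping.keys c. Const (Poly_Mapping.lookup c k) * ?h k)"
  have prod_Lam: "?h m * ?h v \<in> Lam F n" by (intro Lam_mult interp_poly_Lam m v)
  have "\<exists>!c. ?Q c"
  proof (rule ex_ex1I)
    define d where "d = laurent_degree (?h m * ?h v)"
    let ?I = "parts_upto n d"
    have I: "finite ?I" "?I \<subseteq> parts n" using finite_parts_upto by (auto simp: parts_upto_def)
    obtain b where b: "\<And>l. l \<in> ?I \<Longrightarrow> (\<Sum>k\<in>?I. binom_coeff F n l k * b k) = eval (?h m * ?h v) l"
      using binom_coeff_system[OF I, of "eval (?h m * ?h v)"] by blast
    let ?g = "\<Sum>k\<in>?I. Const (b k) * ?h k"
    have gLam: "?g \<in> Lam F n" using I(2) by (intro Lam_sum Lam_Const_mult interp_poly_Lam) auto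
    have "laurent_degree (?h k) \<le> fam_deg F * d" if "k \<in> ?I" for k
      using interp_poly_degree[of k] that
      by (auto simp: parts_upto_def intro: order_trans mult_le_mono2)
    then have gdeg: "laurent_degree ?g \<le> fam_deg F * d"
      by (intro laurent_degree_sum laurent_degree_Const_mult)
    have "d \<le> fam_deg F * d" using deg_pos by simp
    then have pdeg: "laurent_degree (?h m * ?h v) \<le> fam_deg F * d" by (simp add: d_def)
    have "eval ?g l = eval (?h m * ?h v) l" if "l \<in> ?I" for l
      using b[OF that] I(2) by (subst eval_lincomb) (auto simp: interp_poly_Lam binom_coeff_def)
    then have "?h m * ?h v + Const (- 1) * ?g = 0"
      using gLam gdeg prod_Lam pdeg
      by (intro interpolation_unique[of _ d] Lam_add Lam_Const_mult laurent_degree_add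
          laurent_degree_Const_mult)
         (auto simp: laurent_eval_add laurent_eval_mult[of _ "Const _"] evaluable_Const
          Lam_evaluable laurent_eval_Const)
    then have g: "?h m * ?h v = ?g" by (simp add: Const_simps)
    define c where "c = (\<Sum>k\<in>?I. Poly_Mapping.single k (b k))"
    have c: "Poly_Mapping.lookup c k = (if k \<in> ?I then b k else 0)" for k
      using I(1) by (simp add: c_def lookup_sum Poly_Mapping.lookup_single when_def)
    then have keys: "Poly_Mapping.keys c \<subseteq> ?I" by (auto simp: in_keys_iff split: if_splits)
    have "(\<Sum>k\<in>Poly_Mapping.keys c. Const (Poly_Mapping.lookup c k) * ?h k) = ?g"
      using I(1) keys
      by (intro sum.mono_neutral_cong_left) (auto simp: c in_keys_iff Const_simps split: if_splits)
    then show "\<exists>c. ?Q c" using keys I(2) g by (intro exI[of _ c]) auto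
  next
    fix c c' :: "(nat \<Rightarrow> nat) \<Rightarrow>\<^sub>0 'f"
    assume c: "?Q c" "?Q c'"
    let ?I = "Poly_Mapping.keys c \<union> Poly_Mapping.keys c'"
    have I: "finite ?I" "?I \<subseteq> parts n" using c by auto
    have expand: "(\<Sum>k\<in>?I. binom_coeff F n l k * Poly_Mapping.lookup b k) = eval (?h m * ?h v) l"
      if b: "?Q b" "Poly_Mapping.keys b \<subseteq> ?I" for b l
    proof -
      have "(\<Sum>k\<in>?I. binom_coeff F n l k * Poly_Mapping.lookup b k)
          = (\<Sum>k\<in>Poly_Mapping.keys b. eval (?h k) l * Poly_Mapping.lookup b k)"
        using b I(1) by (intro sum.mono_neutral_cong_right) (auto simp: in_keys_iff binom_coeff_def)
      also have "\<dots> = eval (\<Sum>k\<in>Poly_Mapping.keys b. Const (Poly_Mapping.lookup b k) * ?h k) l"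
        using b by (intro eval_lincomb[symmetric] interp_poly_Lam) auto
      finally show ?thesis using b by simp
    qed
    have "(\<Sum>k\<in>?I. binom_coeff F n l k * (Poly_Mapping.lookup c k - Poly_Mapping.lookup c' k)) = 0" for l
      using expand[of c l] expand[of c' l] c by (simp add: right_diff_distrib sum_subtractf)
    then have "Poly_Mapping.lookup c k - Poly_Mapping.lookup c' k = 0" if "k \<in> ?I" for k
      using binom_coeff_system[OF I, THEN conjunct2, rule_format,
          of "\<lambda>k. Poly_Mapping.lookup c k - Poly_Mapping.lookup c' k"] that by simp
    then show "c = c'" by (intro poly_mapping_eqI) (metis Un_iff in_keys_iff eq_iff_diff_eq_0)
  qed
  then have Q: "?Q (THE c. ?Q c)" by (rule theI')
  show ?thesis
  proof (rule that[of "Poly_Mapping.keys (THE c. ?Q c)"])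
    show "LR_coeff F n m v l = 0" if "l \<notin> Poly_Mapping.keys (THE c. ?Q c)" for l
      using that unfolding LR_coeff_def by (simp add: in_keys_iff)
  qed (use Q in \<open>auto simp: LR_coeff_def\<close>)
qed

lemma binom_coeff_mult:
  assumes m: "m \<in> parts n" and v: "v \<in> parts n"
  obtains A where "finite A" "A \<subseteq> parts n" "\<And>k. k \<notin> A \<Longrightarrow> LR_coeff F n m v k = 0"
    "\<And>l. binom_coeff F n l m * binom_coeff F n l v
      = (\<Sum>k\<in>A. binom_coeff F n l k * LR_coeff F n m v k)"
proof -
  obtain A where A: "finite A" "A \<subseteq> parts n" "\<And>l. l \<notin> A \<Longrightarrow> LR_coeff F n m v l = 0"
    and prod: "interp_poly F n m * interp_poly F n v =
      (\<Sum>k\<in>A. Const (LR_coeff F n m v k) * interp_poly F n k)"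
    using LR_expansion[OF m v] by blast
  have "binom_coeff F n l m * binom_coeff F n l v
      = (\<Sum>k\<in>A. binom_coeff F n l k * LR_coeff F n m v k)" for l
    unfolding binom_coeff_def eval_mult[OF interp_poly_Lam[OF m] interp_poly_Lam[OF v], symmetric] prod
    using A(2) by (intro eval_lincomb interp_poly_Lam) auto
  with A show ?thesis by (rule that)
qed

text \<open>Evaluate \<open>h\<^sub>m h\<^sub>v\<close> at the node of \<open>l\<close>. The left-hand side vanishes unless \<open>l = m\<close>, and by induction on the
  weight only the coefficient at \<open>l\<close> itself can contribute to the right-hand side.\<close>

lemma LR_coeff_low_weight:
  assumes m: "m \<in> parts n" and v: "v \<in> parts n" and "l \<in> parts n" "weight n l \<le> weight n m"
  shows "LR_coeff F n m v l = (if l = m then binom_coeff F n m v else 0)"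
  using assms(3,4)
proof (induction "weight n l" arbitrary: l rule: less_induct)
  case less
  obtain A where A: "finite A" "A \<subseteq> parts n" and A0: "\<And>k. k \<notin> A \<Longrightarrow> LR_coeff F n m v k = 0"
    and prod: "\<And>l. binom_coeff F n l m * binom_coeff F n l v
      = (\<Sum>k\<in>A. binom_coeff F n l k * LR_coeff F n m v k)"
    using binom_coeff_mult[OF m v] by blast
  have "binom_coeff F n l k * LR_coeff F n m v k = (if k = l then LR_coeff F n m v l else 0)"
    if "k \<in> A" for k
  proof (cases "k = l")
    case True
    then show ?thesis using eval_interp_poly[OF less.prems(1,1)] by simp
  next
    case False
    have k: "k \<in> parts n" using A(2) that by blast
    show ?thesis
    proof (cases "weight n k < weight n l")
      case True
      then have "LR_coeff F n m v k = 0" using less.hyps[OF True k] less.prems(2) by auto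
      then show ?thesis using False by simp
    next
      case False
      then show ?thesis using \<open>k \<noteq> l\<close> eval_interp_poly[OF k less.prems(1)] by simp
    qed
  qed
  then have "binom_coeff F n l m * binom_coeff F n l v
      = (\<Sum>k\<in>A. if k = l then LR_coeff F n m v l else 0)"
    unfolding prod by (intro sum.cong) auto
  also have "\<dots> = LR_coeff F n m v l" using A(1) A0 by auto
  finally show ?case using eval_interp_poly[OF m less.prems] by auto
qed

text \<open>Evaluate \<open>h\<^sub>m h\<^sub>v\<close> at the node of \<open>l\<close>: apart from \<open>h\<^sub>l\<close>, whose value there is 1, the only summand left is
  that of \<open>h\<^sub>m\<close>, whose coefficient is \<open>b\<^bsub>mv\<^esub>\<close>.\<close>

theorem LR_coeff_cover:
  assumes l: "l \<in> parts n" and m: "m \<in> parts n" and v: "v \<in> parts n" and cov: "covers n l m"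
  shows "LR_coeff F n m v l
    = adj_binom_coeff F n l m * (binom_coeff F n l v - binom_coeff F n m v)"
proof -
  obtain A where A: "finite A" "A \<subseteq> parts n" and A0: "\<And>k. k \<notin> A \<Longrightarrow> LR_coeff F n m v k = 0"
    and prod: "\<And>l. binom_coeff F n l m * binom_coeff F n l v
      = (\<Sum>k\<in>A. binom_coeff F n l k * LR_coeff F n m v k)"
    using binom_coeff_mult[OF m v] by blast
  have weight: "weight n l = weight n m + 1" and neq: "l \<noteq> m"
    using cov by (auto simp: covers_def)
  have "binom_coeff F n l k * LR_coeff F n m v k
      = (if k = l then LR_coeff F n m v l else 0)
        + (if k = m then binom_coeff F n l m * binom_coeff F n m v else 0)"
    if "k \<in> A" for k
  proof -
    have k: "k \<in> parts n" using A(2) that by blast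
    consider "k = l" | "k = m" | "k \<noteq> l" "k \<noteq> m" "weight n k \<le> weight n m"
      | "k \<noteq> l" "k \<noteq> m" "weight n l \<le> weight n k"
      using weight by linarith
    then show ?thesis
      by cases (use neq eval_interp_poly[OF k l] LR_coeff_low_weight[OF m v k] in auto)
  qed
  then have "binom_coeff F n l m * binom_coeff F n l v
      = (\<Sum>k\<in>A. if k = l then LR_coeff F n m v l else 0)
      + (\<Sum>k\<in>A. if k = m then binom_coeff F n l m * binom_coeff F n m v else 0)"
    unfolding prod sum.distrib[symmetric] by (intro sum.cong) auto
  also have "(\<Sum>k\<in>A. if k = l then LR_coeff F n m v l else 0) = LR_coeff F n m v l"
    using A(1) A0 by auto
  also have "(\<Sum>k\<in>A. if k = m then binom_coeff F n l m * binom_coeff F n m v else 0)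
      = binom_coeff F n l m * binom_coeff F n m v"
    using A(1) A0[of m] LR_coeff_low_weight[OF m v m] by auto
  finally show ?thesis by (simp add: adj_binom_coeff_def algebra_simps)
qed

text \<open>Each summand is a difference of binomial coefficients by \<open>LR_coeff_cover\<close>, the adjacent binomial
  coefficient being nonzero, and the sum telescopes.\<close>

theorem binom_coeff_diff_chain:
  assumes v: "v \<in> parts n" and chain: "saturated_chain n zs l m"
  shows "binom_coeff F n l v - binom_coeff F n m v =
    (\<Sum>i<weight n l - weight n m.
      LR_coeff F n (zs ! Suc i) v (zs ! i) / adj_binom_coeff F n (zs ! i) (zs ! Suc i))"
proof -
  define k where "k = weight n l - weight n m"
  have zs: "set zs \<subseteq> parts n" "length zs = k + 1" "hd zs = l" "last zs = m"
    and cov: "\<And>i. i < k \<Longrightarrow> covers n (zs ! i) (zs ! Suc i)"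
    using chain by (auto simp: saturated_chain_def k_def)
  have ends: "zs ! 0 = l" "zs ! k = m"
    using zs hd_conv_nth[of zs] last_conv_nth[of zs] by force+
  have "LR_coeff F n (zs ! Suc i) v (zs ! i) / adj_binom_coeff F n (zs ! i) (zs ! Suc i)
      = binom_coeff F n (zs ! i) v - binom_coeff F n (zs ! Suc i) v" if "i < k" for i
  proof -
    have "zs ! i \<in> parts n" "zs ! Suc i \<in> parts n"
      using that zs(1,2) nth_mem[of i zs] nth_mem[of "Suc i" zs] by auto
    then show ?thesis
      using LR_coeff_cover[OF _ _ v cov[OF that]] adj_binom_coeff_nonzero[OF _ _ cov[OF that]] by simp
  qed
  then have "(\<Sum>i<k. LR_coeff F n (zs ! Suc i) v (zs ! i) / adj_binom_coeff F n (zs ! i) (zs ! Suc i))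
      = (\<Sum>i<k. binom_coeff F n (zs ! i) v - binom_coeff F n (zs ! Suc i) v)"
    by (intro sum.cong) auto
  also have "\<dots> = binom_coeff F n l v - binom_coeff F n m v"
    using sum_lessThan_telescope'[of "\<lambda>i. binom_coeff F n (zs ! i) v" k] by (simp add: ends)
  finally show ?thesis by (simp add: k_def)
qed

end

section \<open>The four families\<close>

text \<open>A ring homomorphism from an integral domain to a field extends to the fractions whose denominator
  it does not kill; this extension is the specialisation relation.\<close>

locale evaluation_hom =
  fixes ev :: "'d::idom \<Rightarrow> 'k::field"
  assumes ev_1: "ev 1 = 1"
    and ev_add: "ev (p + r) = ev p + ev r"
    and ev_mult: "ev (p * r) = ev p * ev r"
begin

definition specializes :: "'d fract \<Rightarrow> 'k \<Rightarrow> bool" where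
  "specializes x a \<longleftrightarrow> (\<exists>p s. ev s \<noteq> 0 \<and> x = Fract p s \<and> a = ev p / ev s)"

lemma ev_0: "ev 0 = 0"
  using ev_add[of 0 0] by (metis add.right_neutral add_left_cancel)

lemma ev_uminus: "ev (- p) = - ev p"
  using ev_add[of p "- p"] by (simp add: ev_0 eq_neg_iff_add_eq_0 add.commute)

lemma ev_nonzero: "ev s \<noteq> 0 \<Longrightarrow> s \<noteq> 0"
  using ev_0 by auto

lemma specializes_Fract_1: "specializes (Fract p 1) (ev p)"
  unfolding specializes_def by (intro exI[of _ p] exI[of _ 1]) (simp add: ev_1)

sublocale specialization specializes
proof
  show "specializes 1 1"
    using specializes_Fract_1[of 1] by (simp add: ev_1 One_fract_def)
  fix x y :: "'d fract" and a b :: 'k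
  assume "specializes x a"
  then obtain p s where x: "ev s \<noteq> 0" "x = Fract p s" "a = ev p / ev s"
    unfolding specializes_def by blast
  show "specializes (- x) (- a)"
    unfolding specializes_def using x
    by (intro exI[of _ "- p"] exI[of _ s]) (simp add: ev_uminus)
  show "x \<noteq> 0" if "a \<noteq> 0"
    using x that ev_nonzero[of s] by (auto simp: Zero_fract_def eq_fract ev_0)
  assume "specializes y b"
  then obtain p' s' where y: "ev s' \<noteq> 0" "y = Fract p' s'" "b = ev p' / ev s'"
    unfolding specializes_def by blast
  note nz = ev_nonzero[OF x(1)] ev_nonzero[OF y(1)]
  show "specializes (x + y) (a + b)"
    unfolding specializes_def using x y nz
    by (intro exI[of _ "p * s' + p' * s"] exI[of _ "s * s'"])
       (simp add: ev_add ev_mult field_simps)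
  show "specializes (x * y) (a * b)"
    unfolding specializes_def using x y
    by (intro exI[of _ "p * p'"] exI[of _ "s * s'"]) (simp add: ev_mult)
  show "specializes (x / y) (a / b)" if "b \<noteq> 0"
    unfolding specializes_def using x y that
    by (intro exI[of _ "p * s'"] exI[of _ "s * p'"]) (simp add: ev_mult)
qed

end

lemma laurent_eval_var:
  "laurent_eval (Poly_Mapping.single (Poly_Mapping.single i s) c) x = c * x i powi s"
  by (simp add: laurent_eval_single eval_monom_def)

text \<open>The special points, with the outermost variable substituted first: \<open>\<tau> = 0\<close>; \<open>\<alpha> = 1\<close>, \<open>\<tau> = 0\<close>; \<open>t = 1\<close>,
  \<open>q = 2\<close>; and \<open>a = 1\<close>, \<open>t = 1\<close>, \<open>q = 2\<close>. Each removes the dependence of a node on the position of the part.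
  In the two type \<open>B\<close> cases the extra parameter must keep the values \<open>(m + \<alpha>)\<^sup>2\<close> and
  \<open>a q\<^sup>m + 1/(a q\<^sup>m)\<close> strictly increasing in \<open>m\<close>.\<close>

interpretation AJ: evaluation_hom "\<lambda>p :: rat poly. poly p 0"
  by unfold_locales auto

interpretation BJ: evaluation_hom "\<lambda>p :: rat poly poly. poly (poly p 1) 0"
  by unfold_locales auto

interpretation AM: evaluation_hom "\<lambda>p :: rat poly poly. poly (poly p 1) 2"
  by unfold_locales auto

interpretation BM: evaluation_hom "\<lambda>p :: rat poly poly poly. poly (poly (poly p 1) 1) 2"
  by unfold_locales auto

lemma AJ_family:
  assumes "1 \<le> n"
  shows "interpolation_family AJ.specializes AJ n {1} (\<lambda>_. 1) of_nat"
proof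
  have \<tau>: "AJ.specializes (Fract [:0, 1:] 1) 0"
    using AJ.specializes_Fract_1[of "[:0, 1:]"] by simp
  fix i :: nat and l :: "nat \<Rightarrow> nat"
  have "AJ.specializes (fam_shift AJ n l i) (of_nat (l i) + of_nat (n - i) * 0)"
    unfolding AJ_def Let_def family.simps
    by (intro AJ.sp_add AJ.sp_mult AJ.sp_of_nat \<tau>)
  then show "AJ.specializes (laurent_eval (fam_gen AJ i) (fam_shift AJ n l)) (of_nat (l i))"
    by (simp add: AJ_def Let_def X_def laurent_eval_var)
qed (use assms in \<open>auto simp: AJ_def Let_def X_def strict_mono_def\<close>)

lemma BJ_family:
  assumes "1 \<le> n"
  shows "interpolation_family BJ.specializes BJ n {2} (\<lambda>_. 1) (\<lambda>m. (of_nat m + 1) ^ 2)"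
proof
  have gen: "fam_gen BJ i = Poly_Mapping.single (Poly_Mapping.single i 2) 1" for i
    by (simp add: BJ_def Let_def X_def power2_eq_square mult_single flip: single_add)
  then show "fam_gen BJ i = (\<Sum>s\<in>{2}. Poly_Mapping.single (Poly_Mapping.single i s) 1)" for i
    by simp
  have \<tau>: "BJ.specializes (Fract [:[:0, 1:]:] 1) 0" and \<alpha>: "BJ.specializes (Fract [:0, 1:] 1) 1"
    using BJ.specializes_Fract_1[of "[:[:0, 1:]:]"] BJ.specializes_Fract_1[of "[:0, 1:]"] by simp_all
  fix i :: nat and l :: "nat \<Rightarrow> nat"
  have "BJ.specializes (fam_shift BJ n l i ^ 2) ((of_nat (l i) + of_nat (n - i) * 0 + 1) ^ 2)"
    unfolding BJ_def Let_def family.simps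
    by (intro BJ.sp_power BJ.sp_add BJ.sp_mult BJ.sp_of_nat \<tau> \<alpha>)
  then show "BJ.specializes (laurent_eval (fam_gen BJ i) (fam_shift BJ n l)) ((of_nat (l i) + 1) ^ 2)"
    by (simp add: gen laurent_eval_var)
qed (use assms in \<open>auto simp: BJ_def Let_def strict_mono_def intro!: power_strict_mono\<close>)

lemma AM_family:
  assumes "1 \<le> n"
  shows "interpolation_family AM.specializes AM n {1} (\<lambda>_. 1) (\<lambda>m. 2 ^ m)"
proof
  have q: "AM.specializes (Fract [:[:0, 1:]:] 1) 2" and t: "AM.specializes (Fract [:0, 1:] 1) 1"
    using AM.specializes_Fract_1[of "[:[:0, 1:]:]"] AM.specializes_Fract_1[of "[:0, 1:]"] by simp_all
  fix i :: nat and l :: "nat \<Rightarrow> nat"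
  have "AM.specializes (fam_shift AM n l i) (2 ^ l i * 1 ^ (n - i))"
    unfolding AM_def Let_def family.simps by (intro AM.sp_mult AM.sp_power q t)
  then show "AM.specializes (laurent_eval (fam_gen AM i) (fam_shift AM n l)) (2 ^ l i)"
    by (simp add: AM_def Let_def X_def laurent_eval_var)
qed (use assms in \<open>auto simp: AM_def Let_def X_def strict_mono_def\<close>)

lemma BM_family:
  assumes "1 \<le> n"
  shows "interpolation_family BM.specializes BM n {1, - 1} (\<lambda>_. 1) (\<lambda>m. 2 ^ m + 1 / 2 ^ m)"
proof
  have q: "BM.specializes (Fract [:[:[:0, 1:]:]:] 1) 2"
    and t: "BM.specializes (Fract [:[:0, 1:]:] 1) 1" and a: "BM.specializes (Fract [:0, 1:] 1) 1"
    using BM.specializes_Fract_1[of "[:[:[:0, 1:]:]:]"] BM.specializes_Fract_1[of "[:[:0, 1:]:]"]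
      BM.specializes_Fract_1[of "[:0, 1:]"] by simp_all
  fix i :: nat and l :: "nat \<Rightarrow> nat"
  have "BM.specializes (fam_shift BM n l i) (1 * 2 ^ l i * 1 ^ (n - i))"
    unfolding BM_def Let_def family.simps by (intro BM.sp_mult BM.sp_power q t a)
  then have x: "BM.specializes (fam_shift BM n l i) (2 ^ l i)" by simp
  show "fam_shift BM n l i \<noteq> 0" by (rule BM.sp_nonzero[OF x]) simp
  have "BM.specializes (fam_shift BM n l i + 1 / fam_shift BM n l i) (2 ^ l i + 1 / 2 ^ l i)"
    by (intro BM.sp_add BM.sp_divide x BM.sp_1) simp
  moreover have "laurent_eval (fam_gen BM i) x = x i + 1 / x i" for x
    by (simp add: BM_def Let_def X_def X_inv_def laurent_eval_add laurent_eval_var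
        power_int_minus divide_inverse)
  ultimately show "BM.specializes (laurent_eval (fam_gen BM i) (fam_shift BM n l))
      (2 ^ l i + 1 / 2 ^ l i)" by simp
next
  have "2 ^ m + 1 / 2 ^ m < 2 ^ Suc m + (1 / 2 ^ Suc m :: rat)" for m
  proof -
    have "1 \<le> (2 ^ m :: rat)" by simp
    then have "1 / 2 ^ m \<le> (1 :: rat)" by simp
    moreover have "0 < 1 / (2 ^ Suc m :: rat)" by simp
    ultimately show ?thesis using \<open>1 \<le> (2 ^ m :: rat)\<close> unfolding power_Suc by linarith
  qed
  then show "strict_mono (\<lambda>m. 2 ^ m + 1 / 2 ^ m :: rat)" unfolding strict_mono_Suc_iff by blast
qed (use assms in \<open>auto simp: BM_def Let_def X_def X_inv_def\<close>)

theorem corollary3p8: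
  fixes n :: nat and l \<mu> \<nu> :: "nat \<Rightarrow> nat"
  assumes "n \<ge> 1" and "l \<in> parts n" and "\<mu> \<in> parts n" and "\<nu> \<in> parts n"
  shows "(covers n l \<mu> \<longrightarrow>
        LR_coeff AJ n \<mu> \<nu> l = adj_binom_coeff AJ n l \<mu> * (binom_coeff AJ n l \<nu> - binom_coeff AJ n \<mu> \<nu>) \<and>
        LR_coeff BJ n \<mu> \<nu> l = adj_binom_coeff BJ n l \<mu> * (binom_coeff BJ n l \<nu> - binom_coeff BJ n \<mu> \<nu>) \<and>
        LR_coeff AM n \<mu> \<nu> l = adj_binom_coeff AM n l \<mu> * (binom_coeff AM n l \<nu> - binom_coeff AM n \<mu> \<nu>) \<and>
        LR_coeff BM n \<mu> \<nu> l = adj_binom_coeff BM n l \<mu> * (binom_coeff BM n l \<nu> - binom_coeff BM n \<mu> \<nu>)) \<and>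
     (contains n l \<mu> \<longrightarrow> (\<forall>zs. saturated_chain n zs l \<mu> \<longrightarrow>
        binom_coeff AJ n l \<nu> - binom_coeff AJ n \<mu> \<nu> =
          (\<Sum>i<weight n l - weight n \<mu>. LR_coeff AJ n (zs ! Suc i) \<nu> (zs ! i) / adj_binom_coeff AJ n (zs ! i) (zs ! Suc i)) \<and>
        binom_coeff BJ n l \<nu> - binom_coeff BJ n \<mu> \<nu> =
          (\<Sum>i<weight n l - weight n \<mu>. LR_coeff BJ n (zs ! Suc i) \<nu> (zs ! i) / adj_binom_coeff BJ n (zs ! i) (zs ! Suc i)) \<and>
        binom_coeff AM n l \<nu> - binom_coeff AM n \<mu> \<nu> =
          (\<Sum>i<weight n l - weight n \<mu>. LR_coeff AM n (zs ! Suc i) \<nu> (zs ! i) / adj_binom_coeff AM n (zs ! i) (zs ! Suc i)) \<and>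
        binom_coeff BM n l \<nu> - binom_coeff BM n \<mu> \<nu> =
          (\<Sum>i<weight n l - weight n \<mu>. LR_coeff BM n (zs ! Suc i) \<nu> (zs ! i) / adj_binom_coeff BM n (zs ! i) (zs ! Suc i))))"
proof -
  note families = AJ_family[OF assms(1)] BJ_family[OF assms(1)] AM_family[OF assms(1)]
    BM_family[OF assms(1)]
  note cover = families[THEN interpolation_family.LR_coeff_cover, OF assms(2-4)]
  note chain = families[THEN interpolation_family.binom_coeff_diff_chain, OF assms(4)]
  show ?thesis by (intro conjI impI allI cover chain)
qed

end
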